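(* Let $X$ be a Peano continuum, $y_0\in X$, $\{x_j\}_{j\in\mathbb{N}}$ a sequence in $X$, $(A_j,a_j)$ ($j\in\mathbb{N}$) based spaces, and $Y=\operatorname{\bf Adj}(X,x_j,A_j,a_j)$. Then for all $n\geq 2$, the canonical homomorphism \[\Psi:\pi_n(Y,y_0)\to \pi_n(X,y_0)\oplus\prod_{j\in\mathbb{N}}\pi_n(A_j,a_j),\qquad \Psi([f])=([r\circ f],[r_1\circ f],[r_2\circ f],\dots)\] is a split epimorphism.
   Context: All spaces Hausdorff; Peano continuum = connected, locally path-connected compact metric space. $\operatorname{\bf Adj}(X,x_j,A_j,a_j)$: $Y_k$ is the adjunction space obtained from $X\sqcup A_1\sqcup\dots\sqcup A_k$ by identifying $a_j\sim x_j$ ($j\le k$), $\rho_{k+1,k}:Y_{k+1}\to Y_k$ collapses $A_{k+1}$ to $x_{k+1}$, and the space is $\varprojlim_k Y_k$ with subspace topology in $\prod_kY_k$; its underlying set is $(X\sqcup\coprod_jA_j)/(a_j\sim x_j)$. $r:Y\to X$ is the retraction collapsing each $A_j$ to $x_j$; $r_j:Y\to A_j$ is the retraction collapsing $X$ and all $A_i$, $i\ne j$, to $a_j$. *)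

theory Defs
  imports "HOL-Analysis.Analysis" "HOL-Algebra.Product_Groups"
begin

definition peano_continuum :: "'a topology \<Rightarrow> bool" where
  "peano_continuum X \<longleftrightarrow> metrizable_space X \<and> compact_space X \<and> connected_space X
      \<and> locally_path_connected_space X"

definition cube :: "nat \<Rightarrow> (nat \<Rightarrow> real) topology" where
  "cube n = product_topology (\<lambda>i. top_of_set {0..1}) {..<n}"

definition cube_bdry :: "nat \<Rightarrow> (nat \<Rightarrow> real) set" where
  "cube_bdry n = {t \<in> topspace (cube n). \<exists>i<n. t i = 0 \<or> t i = 1}"

definition hclass :: "nat \<Rightarrow> 'a topology \<Rightarrow> 'a \<Rightarrow> ((nat \<Rightarrow> real) \<Rightarrow> 'a)
                        \<Rightarrow> ((nat \<Rightarrow> real) \<Rightarrow> 'a) set" where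
  "hclass n Z z f = {g. homotopic_with (\<lambda>h. h ` cube_bdry n \<subseteq> {z}) (cube n) Z f g}"

definition cube_concat :: "((nat \<Rightarrow> real) \<Rightarrow> 'a) \<Rightarrow> ((nat \<Rightarrow> real) \<Rightarrow> 'a) \<Rightarrow> (nat \<Rightarrow> real) \<Rightarrow> 'a" where
  "cube_concat f g = (\<lambda>t. if t 0 \<le> 1/2 then f (t(0 := 2 * t 0)) else g (t(0 := 2 * t 0 - 1)))"

definition homotopy_group :: "nat \<Rightarrow> 'a topology \<Rightarrow> 'a \<Rightarrow> ((nat \<Rightarrow> real) \<Rightarrow> 'a) set monoid" where
  "homotopy_group n Z z =
    \<lparr> carrier = {hclass n Z z f | f. continuous_map (cube n) Z f \<and> f ` cube_bdry n \<subseteq> {z}},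
      mult = (\<lambda>C D. hclass n Z z (cube_concat (SOME f. f \<in> C) (SOME g. g \<in> D))),
      one = hclass n Z z (\<lambda>t. z) \<rparr>"

definition induced_hom :: "nat \<Rightarrow> 'b topology \<Rightarrow> 'b \<Rightarrow> ('a \<Rightarrow> 'b)
      \<Rightarrow> ((nat \<Rightarrow> real) \<Rightarrow> 'a) set \<Rightarrow> ((nat \<Rightarrow> real) \<Rightarrow> 'b) set" where
  "induced_hom n W w \<phi> C = hclass n W w (\<phi> \<circ> (SOME f. f \<in> C))"

text \<open>Points of the finite stages are represented in the type 'a + nat * 'b:
  Inl x for x in X and Inr (j, b) for b a point of A_j (indices j start at 0).
  The stage Y_k contains A_0, ..., A_(k-1).\<close>

definition disj_sum_top :: "'a topology \<Rightarrow> (nat \<Rightarrow> 'b topology) \<Rightarrow> nat \<Rightarrow> ('a + nat \<times> 'b) topology" where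
  "disj_sum_top X A k = topology (\<lambda>U.
      U \<subseteq> Inl ` topspace X \<union> (\<Union>j<k. (\<lambda>b. Inr (j, b)) ` topspace (A j))
      \<and> openin X {x. Inl x \<in> U} \<and> (\<forall>j<k. openin (A j) {b. Inr (j, b) \<in> U}))"

definition quotient_top :: "'a topology \<Rightarrow> ('a \<Rightarrow> 'b) \<Rightarrow> 'b topology" where
  "quotient_top T q = topology (\<lambda>U. U \<subseteq> q ` topspace T \<and> openin T {x \<in> topspace T. q x \<in> U})"

definition adj_quot :: "(nat \<Rightarrow> 'a) \<Rightarrow> (nat \<Rightarrow> 'b) \<Rightarrow> ('a + nat \<times> 'b) \<Rightarrow> ('a + nat \<times> 'b)" where
  "adj_quot x a p = (case p of Inl y \<Rightarrow> Inl y
                     | Inr (j, b) \<Rightarrow> if b = a j then Inl (x j) else Inr (j, b))"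

definition adj_stage :: "'a topology \<Rightarrow> (nat \<Rightarrow> 'a) \<Rightarrow> (nat \<Rightarrow> 'b topology) \<Rightarrow> (nat \<Rightarrow> 'b)
                          \<Rightarrow> nat \<Rightarrow> ('a + nat \<times> 'b) topology" where
  "adj_stage X x A a k = quotient_top (disj_sum_top X A k) (adj_quot x a)"

definition adj_bond :: "(nat \<Rightarrow> 'a) \<Rightarrow> nat \<Rightarrow> ('a + nat \<times> 'b) \<Rightarrow> ('a + nat \<times> 'b)" where
  "adj_bond x k p = (case p of Inl y \<Rightarrow> Inl y
                     | Inr (j, b) \<Rightarrow> if j = k then Inl (x k) else Inr (j, b))"

definition Adj :: "'a topology \<Rightarrow> (nat \<Rightarrow> 'a) \<Rightarrow> (nat \<Rightarrow> 'b topology) \<Rightarrow> (nat \<Rightarrow> 'b)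
                     \<Rightarrow> (nat \<Rightarrow> 'a + nat \<times> 'b) topology" where
  "Adj X x A a = subtopology (product_topology (adj_stage X x A a) UNIV)
      {y \<in> topspace (product_topology (adj_stage X x A a) UNIV). \<forall>k. y k = adj_bond x k (y (Suc k))}"

definition adj_incl :: "'a \<Rightarrow> (nat \<Rightarrow> 'a + nat \<times> 'b)" where
  "adj_incl y = (\<lambda>k. Inl y)"

text \<open>r : Y -> X, collapsing each A_j to x_j (projection to Y_0 = X).\<close>

definition adj_r :: "(nat \<Rightarrow> 'a + nat \<times> 'b) \<Rightarrow> 'a" where
  "adj_r y = projl (y 0)"

definition adj_rj :: "(nat \<Rightarrow> 'b) \<Rightarrow> nat \<Rightarrow> (nat \<Rightarrow> 'a + nat \<times> 'b) \<Rightarrow> 'b" where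
  "adj_rj a j y = (case y (Suc j) of Inl _ \<Rightarrow> a j
                   | Inr (i, b) \<Rightarrow> if i = j then b else a j)"

definition adj_Psi :: "nat \<Rightarrow> 'a topology \<Rightarrow> 'a \<Rightarrow> (nat \<Rightarrow> 'b topology) \<Rightarrow> (nat \<Rightarrow> 'b)
     \<Rightarrow> ((nat \<Rightarrow> real) \<Rightarrow> (nat \<Rightarrow> 'a + nat \<times> 'b)) set
     \<Rightarrow> ((nat \<Rightarrow> real) \<Rightarrow> 'a) set \<times> (nat \<Rightarrow> ((nat \<Rightarrow> real) \<Rightarrow> 'b) set)" where
  "adj_Psi n X y0 A a C =
     (induced_hom n X y0 adj_r C, \<lambda>j. induced_hom n (A j) (a j) (adj_rj a j) C)"

end

theory Submission
  imports Defs
begin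

text \<open>
  A point of \<open>Y\<close> is determined by its images under the retractions to \<open>X\<close> and the \<open>A j\<close>, and a map
  into \<open>Y\<close> is continuous as soon as its composites with these retractions are. So a map into \<open>Y\<close> is a
  map \<open>H\<close> into \<open>X\<close> together with maps \<open>G j\<close> into \<open>A j\<close> with disjoint supports, such that \<open>H = x j\<close> on the
  support of \<open>G j\<close>; no smallness of the \<open>G j\<close> is required.

  Since \<open>X\<close> is a Peano continuum there is a path \<open>\<beta>\<close> from \<open>y0\<close> that rests at \<open>x j\<close> during an interval
  \<open>J j\<close>, the intervals being pairwise disjoint. Given \<open>g j\<close> on \<open>A j\<close> for all \<open>j\<close>, let \<open>H\<close> run along \<open>\<beta>\<close> in
  direction \<open>1\<close> (contracted to \<open>y0\<close> towards the boundary, hence null-homotopic) and place \<open>g j\<close> in a box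
  over \<open>J j\<close>. This splits off the product of the \<open>\<pi>\<^sub>n(A j)\<close>. It is multiplicative because the group operation
  concatenates in direction \<open>0\<close>, along which \<open>\<beta>\<close> is constant: the wall between two factors can be removed
  for all \<open>j\<close> simultaneously. As \<open>\<pi>\<^sub>n(Y)\<close> is commutative, multiplying with the inclusion of \<open>\<pi>\<^sub>n(X)\<close> gives
  a section of \<open>\<Psi>\<close>.
\<close>

section \<open>Paths resting at a given sequence\<close>

lemma (in Metric_space) uniformly_locally_path_connected:
  assumes "compact_space mtopology" "locally_path_connected_space mtopology" "0 < \<epsilon>"
  obtains \<delta> where "0 < \<delta>"
    "\<And>p q. \<lbrakk>p \<in> M; q \<in> M; d p q < \<delta>\<rbrakk> \<Longrightarrow>
       \<exists>\<gamma>. pathin mtopology \<gamma> \<and> \<gamma> 0 = p \<and> \<gamma> 1 = q \<and> (\<forall>t\<in>{0..1}. d p (\<gamma> t) \<le> \<epsilon>)"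
proof -
  define \<C> where "\<C> = {U. openin mtopology U \<and> path_connectedin mtopology U \<and> (\<exists>c\<in>M. U \<subseteq> mball c (\<epsilon>/2))}"
  have "M \<subseteq> \<Union>\<C>"
  proof
    fix p assume "p \<in> M"
    with assms(3) have "openin mtopology (mball p (\<epsilon>/2))" "p \<in> mball p (\<epsilon>/2)" by auto
    then obtain U where "openin mtopology U" "path_connectedin mtopology U" "p \<in> U" "U \<subseteq> mball p (\<epsilon>/2)"
      using assms(2) unfolding locally_path_connected_space by metis
    with \<open>p \<in> M\<close> show "p \<in> \<Union>\<C>" unfolding \<C>_def by blast
  qed
  moreover have "compactin mtopology M" "\<And>U. U \<in> \<C> \<Longrightarrow> openin mtopology U"
    using assms(1) by (simp_all add: compact_space_def \<C>_def)
  ultimately obtain \<delta> where "0 < \<delta>" and \<delta>: "\<And>p. p \<in> M \<Longrightarrow> \<exists>U\<in>\<C>. mball p \<delta> \<subseteq> U"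
    using lebesgue_number[of M \<C>] by metis
  show thesis
  proof (rule that[OF \<open>0 < \<delta>\<close>])
    fix p q assume pq: "p \<in> M" "q \<in> M" "d p q < \<delta>"
    obtain U where "U \<in> \<C>" "mball p \<delta> \<subseteq> U" using \<delta>[OF pq(1)] by blast
    then obtain c where U: "path_connectedin mtopology U" "U \<subseteq> mball c (\<epsilon>/2)"
      unfolding \<C>_def by blast
    have "p \<in> U" "q \<in> U" using \<open>mball p \<delta> \<subseteq> U\<close> pq \<open>0 < \<delta>\<close> by (auto simp: subset_iff)
    then obtain \<gamma> where \<gamma>: "pathin mtopology \<gamma>" "\<gamma> ` {0..1} \<subseteq> U" "\<gamma> 0 = p" "\<gamma> 1 = q"
      using U(1) unfolding path_connectedin by (metis image_subset_iff_funcset)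
    have "d p (\<gamma> t) \<le> \<epsilon>" if "t \<in> {0..1}" for t
    proof -
      have "\<gamma> t \<in> mball c (\<epsilon>/2)" "p \<in> mball c (\<epsilon>/2)" using U(2) \<gamma>(2) \<open>p \<in> U\<close> that by blast+
      then show ?thesis using triangle[of p c "\<gamma> t"] commute[of p c] by auto
    qed
    with \<gamma> show "\<exists>\<gamma>. pathin mtopology \<gamma> \<and> \<gamma> 0 = p \<and> \<gamma> 1 = q \<and> (\<forall>t\<in>{0..1}. d p (\<gamma> t) \<le> \<epsilon>)"
      by blast
  qed
qed

lemma (in Metric_space) initial_segment_net:
  fixes x :: "nat \<Rightarrow> 'a"
  assumes "mtotally_bounded (range x)" "0 < \<epsilon>"
  obtains k where "\<And>j. \<exists>i\<le>k. d (x i) (x j) < \<epsilon>"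
proof -
  obtain K where "finite K" "K \<subseteq> range x" and K: "range x \<subseteq> (\<Union>y\<in>K. mball y \<epsilon>)"
    using assms unfolding mtotally_bounded_def by metis
  then obtain I where I: "finite I" "K = x ` I" by (meson finite_subset_image)
  have "\<exists>i\<le>Max I. d (x i) (x j) < \<epsilon>" for j
  proof -
    have "x j \<in> (\<Union>y\<in>K. mball y \<epsilon>)" using K by (rule subsetD) simp
    then obtain i where "i \<in> I" "x j \<in> mball (x i) \<epsilon>" using I(2) by auto
    then show ?thesis using I(1) by (intro exI[of _ i]) auto
  qed
  then show thesis by (rule that)
qed

text \<open>The level of \<open>j\<close> is the first \<open>m\<close> for which \<open>j\<close> lies in the \<open>m\<close>-th of an increasing sequence of
  finer and finer finite nets; its predecessor lies in the previous net.\<close>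

lemma (in Metric_space) close_predecessors:
  fixes x :: "nat \<Rightarrow> 'a" and \<delta> :: "nat \<Rightarrow> real"
  assumes "mtotally_bounded (range x)" "\<And>m. 0 < \<delta> m"
  obtains lev par :: "nat \<Rightarrow> nat" where
    "\<And>j. par (Suc j) \<le> j" "\<And>m. finite {j. lev j \<le> m}"
    "\<And>j. 0 < lev j \<Longrightarrow> lev (par j) < lev j \<and> d (x (par j)) (x j) < \<delta> (lev j)"
proof -
  have "\<exists>k. \<forall>j. \<exists>i\<le>k. d (x i) (x j) < \<delta> (Suc m)" for m
    using initial_segment_net[OF assms(1) assms(2)[of "Suc m"]] by blast
  then obtain k where k: "\<And>m j. \<exists>i\<le>k m. d (x i) (x j) < \<delta> (Suc m)" by metis
  define net where "net m = m + (\<Sum>i\<le>m. k i)" for m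
  have net_mono: "net m \<le> net m'" if "m \<le> m'" for m m'
    unfolding net_def using that by (intro add_mono sum_mono2) auto
  have "k m \<le> net m" for m unfolding net_def using member_le_sum[of m "{..m}" k] by simp
  then have net: "\<exists>i\<le>net m. d (x i) (x j) < \<delta> (Suc m)" for m j using k le_trans by meson
  define lev where "lev j = (LEAST m. j \<le> net m)" for j
  have "j \<le> net (lev j)" for j unfolding lev_def by (rule LeastI[of _ j]) (simp add: net_def)
  moreover have "lev j \<le> m" if "j \<le> net m" for j m unfolding lev_def using that by (rule Least_le)
  ultimately have lev_le: "lev j \<le> m \<longleftrightarrow> j \<le> net m" for j m
    by (meson net_mono le_trans)
  have "\<exists>i. (0 < j \<longrightarrow> i < j) \<and> (0 < lev j \<longrightarrow> lev i < lev j \<and> d (x i) (x j) < \<delta> (lev j))" for j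
  proof (cases "lev j")
    case (Suc m)
    then obtain i where "i \<le> net m" "d (x i) (x j) < \<delta> (lev j)" using net by metis
    moreover have "\<not> j \<le> net m" using Suc lev_le[of j m] by simp
    ultimately show ?thesis using Suc lev_le[of i m] by (intro exI[of _ i]) auto
  qed auto
  then obtain par where par: "\<And>j. 0 < j \<Longrightarrow> par j < j"
    "\<And>j. 0 < lev j \<Longrightarrow> lev (par j) < lev j \<and> d (x (par j)) (x j) < \<delta> (lev j)" by metis
  have "finite {j. lev j \<le> m}" for m by (simp add: lev_le)
  moreover have "par (Suc j) \<le> j" for j using par(1)[of "Suc j"] by simp
  ultimately show thesis using par(2) that by blast
qed

definition excursion :: "real \<Rightarrow> real \<Rightarrow> (real \<Rightarrow> 'a) \<Rightarrow> (real \<Rightarrow> 'a) \<Rightarrow> real \<Rightarrow> 'a" where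
  "excursion a b \<gamma> W t =
     (if a \<le> t \<and> t \<le> b then \<gamma> (min 1 (4 * min (t - a) (b - t) / (b - a))) else W t)"

lemma excursion_outside: "t < a \<or> b < t \<Longrightarrow> excursion a b \<gamma> W t = W t"
  by (auto simp: excursion_def)

lemma excursion_inside:
  assumes "a < b" "a \<le> t" "t \<le> b"
  obtains u where "u \<in> {0..1}" "excursion a b \<gamma> W t = \<gamma> u"
  using assms by (intro that[of "min 1 (4 * min (t - a) (b - t) / (b - a))"]) (auto simp: excursion_def)

lemma excursion_ends: "a < b \<Longrightarrow> excursion a b \<gamma> W a = \<gamma> 0" "a < b \<Longrightarrow> excursion a b \<gamma> W b = \<gamma> 0"
  by (simp_all add: excursion_def)

lemma excursion_rest:
  assumes "a < b" "(3 * a + b) / 4 \<le> t" "t \<le> (a + 3 * b) / 4"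
  shows "excursion a b \<gamma> W t = \<gamma> 1"
proof -
  have "1 \<le> 4 * min (t - a) (b - t) / (b - a)" using assms by (simp add: field_simps min_def)
  then show ?thesis using assms by (simp add: excursion_def)
qed

lemma continuous_map_excursion:
  assumes "a < b" "continuous_map (top_of_set S) Z W" "pathin Z \<gamma>" "W a = \<gamma> 0" "W b = \<gamma> 0"
  shows "continuous_map (top_of_set S) Z (excursion a b \<gamma> W)"
proof -
  let ?S = "top_of_set S" and ?h = "\<lambda>t. min (t - a) (b - t)" and ?u = "\<lambda>t. min 1 (4 * min (t - a) (b - t) / (b - a))"
  have "continuous_map ?S Z (\<lambda>t. if 0 \<le> ?h t then \<gamma> (?u t) else W t)"
  proof (rule continuous_map_cases_le)
    have "continuous_map (subtopology ?S {t \<in> topspace ?S. 0 \<le> ?h t}) (top_of_set {0..1}) ?u"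
      using \<open>a < b\<close> by (auto simp: subtopology_subtopology divide_inverse intro!: continuous_intros)
    from continuous_map_compose[OF this, of Z \<gamma>]
    show "continuous_map (subtopology ?S {t \<in> topspace ?S. 0 \<le> ?h t}) Z (\<lambda>t. \<gamma> (?u t))"
      using assms(3) by (simp add: pathin_def o_def)
    show "continuous_map ?S euclideanreal ?h" by (simp add: continuous_intros)
    show "\<gamma> (?u t) = W t" if "0 = ?h t" for t
    proof -
      have "t = a \<or> t = b" using that by (auto simp: min_def split: if_splits)
      then show ?thesis using assms by auto
    qed
  qed (auto intro: assms(2) continuous_map_from_subtopology)
  then show ?thesis by (simp add: excursion_def[abs_def])
qed

text \<open>Each index \<open>i\<close> owns an interval \<open>{lo..hi}\<close> on which the current walk is constant. The part
  \<open>{lo..mid}\<close> is kept for ever; the right half of \<open>{mid..hi}\<close> is handed to the next child.\<close>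

primrec slots :: "(nat \<Rightarrow> nat) \<Rightarrow> nat \<Rightarrow> nat \<Rightarrow> real \<times> real \<times> real" where
  "slots par 0 = (\<lambda>i. (0, 1/2, 1))"
| "slots par (Suc N) =
     (let (lo, mid, hi) = slots par N (par (Suc N)); cut = (mid + hi) / 2
      in (slots par N)(par (Suc N) := (lo, mid, cut),
                       Suc N := ((3 * cut + hi) / 4, (cut + hi) / 2, (cut + 3 * hi) / 4)))"

locale excursion_tree = Metric_space M d for M :: "'a set" and d +
  fixes x :: "nat \<Rightarrow> 'a" and par lev :: "nat \<Rightarrow> nat" and \<gamma> :: "nat \<Rightarrow> real \<Rightarrow> 'a"
  assumes x_in: "x i \<in> M"
    and par_le: "par (Suc N) \<le> N"
    and finite_level: "finite {i. lev i \<le> m}"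
    and lev_par: "0 < lev i \<Longrightarrow> lev (par i) < lev i"
    and path: "pathin mtopology (\<gamma> (Suc N))"
    and path_start: "\<gamma> (Suc N) 0 = x (par (Suc N))"
    and path_finish: "\<gamma> (Suc N) 1 = x (Suc N)"
    and path_close: "\<lbrakk>0 < lev (Suc N); u \<in> {0..1}\<rbrakk> \<Longrightarrow> d (x (par (Suc N))) (\<gamma> (Suc N) u) \<le> 1 / 2 ^ lev (Suc N)"
begin

abbreviation lo :: "nat \<Rightarrow> nat \<Rightarrow> real" where
  "lo N i \<equiv> fst (slots par N i)"

abbreviation mid :: "nat \<Rightarrow> nat \<Rightarrow> real" where
  "mid N i \<equiv> fst (snd (slots par N i))"

abbreviation hi :: "nat \<Rightarrow> nat \<Rightarrow> real" where
  "hi N i \<equiv> snd (snd (slots par N i))"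

abbreviation parent :: "nat \<Rightarrow> nat" where
  "parent N \<equiv> par (Suc N)"

definition departure :: "nat \<Rightarrow> real" where
  "departure N = (mid N (parent N) + hi N (parent N)) / 2"

definition return :: "nat \<Rightarrow> real" where
  "return N = hi N (parent N)"

primrec walk :: "nat \<Rightarrow> real \<Rightarrow> 'a" where
  "walk 0 = (\<lambda>t. x 0)"
| "walk (Suc N) = excursion (departure N) (return N) (\<gamma> (Suc N)) (walk N)"

lemma slots_Suc_new:
  "lo (Suc N) (Suc N) = (3 * departure N + return N) / 4"
  "mid (Suc N) (Suc N) = (departure N + return N) / 2"
  "hi (Suc N) (Suc N) = (departure N + 3 * return N) / 4"
  by (simp_all add: departure_def return_def split_beta Let_def)

lemma slots_Suc_old:
  assumes "i \<le> N"
  shows "lo (Suc N) i = lo N i" "mid (Suc N) i = mid N i"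
    "hi (Suc N) i = (if i = parent N then departure N else hi N i)"
  using assms by (simp_all add: departure_def split_beta Let_def)

declare slots.simps(2)[simp del]

lemma slot_ordered: "i \<le> N \<Longrightarrow> lo N i < mid N i \<and> mid N i < hi N i"
proof (induction N arbitrary: i)
  case (Suc N)
  then have IH: "lo N j < mid N j \<and> mid N j < hi N j" if "j \<le> N" for j using that by blast
  show ?case
  proof (cases "i = Suc N")
    case True
    then show ?thesis using IH[OF par_le] by (simp add: slots_Suc_new departure_def return_def)
  next
    case False
    then show ?thesis using IH[of i] IH[OF par_le] Suc.prems by (simp add: slots_Suc_old departure_def)
  qed
qed simp

lemma parent_slot: "lo N (parent N) < departure N" "departure N < return N" "return N = hi N (parent N)"
  using slot_ordered[OF par_le[of N]] by (simp_all add: departure_def return_def)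

lemma new_slot: "departure N < lo (Suc N) (Suc N)" "hi (Suc N) (Suc N) < return N"
  using parent_slot(2)[of N] by (simp_all add: slots_Suc_new)

lemma slot_Suc_subset: "i \<le> N \<Longrightarrow> {lo (Suc N) i..hi (Suc N) i} \<subseteq> {lo N i..hi N i}"
  using parent_slot[of N] by (auto simp: slots_Suc_old split: if_splits)

lemma slot_antimono:
  assumes "i \<le> N" "N \<le> N'"
  shows "{lo N' i..hi N' i} \<subseteq> {lo N i..hi N i}"
  using assms(2)
proof (induction N' rule: dec_induct)
  case (step N')
  then show ?case using slot_Suc_subset[of i N'] assms(1) by (meson le_trans order.trans)
qed simp

lemma new_slot_subset: "{lo (Suc N) (Suc N)..hi (Suc N) (Suc N)} \<subseteq> {lo N (parent N)..hi N (parent N)}"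
  using new_slot[of N] parent_slot[of N] by auto

lemma slot_in_unit: "i \<le> N \<Longrightarrow> {lo N i..hi N i} \<subseteq> {0..1}"
proof (induction N arbitrary: i)
  case (Suc N)
  show ?case
  proof (cases "i = Suc N")
    case True
    then show ?thesis using new_slot_subset Suc.IH[OF par_le] by blast
  next
    case False
    then show ?thesis using slot_Suc_subset[of i N] Suc.IH[of i] Suc.prems by fastforce
  qed
qed simp

lemma slots_disjoint: "\<lbrakk>i \<le> N; j \<le> N; i \<noteq> j\<rbrakk> \<Longrightarrow> hi N i < lo N j \<or> hi N j < lo N i"
proof (induction N arbitrary: i j)
  case (Suc N)
  have new: "hi (Suc N) k < lo (Suc N) (Suc N) \<or> hi (Suc N) (Suc N) < lo (Suc N) k" if "k \<le> N" for k
  proof (cases "k = parent N")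
    case True
    then show ?thesis using new_slot[of N] that by (simp add: slots_Suc_old)
  next
    case False
    then show ?thesis
      using Suc.IH[OF that par_le False] new_slot[of N] parent_slot[of N] that by (auto simp: slots_Suc_old)
  qed
  consider "i = Suc N" "j \<le> N" | "j = Suc N" "i \<le> N" | "i \<le> N" "j \<le> N" using Suc.prems by linarith
  then show ?case
  proof cases
    case 3
    then show ?thesis using Suc.IH[OF 3 Suc.prems(3)] parent_slot[of N] by (auto simp: slots_Suc_old)
  qed (use new in blast)+
qed simp

lemma rest_subset_slot:
  assumes "i \<le> N"
  shows "{lo i i..mid i i} \<subseteq> {lo N i..hi N i}"
proof -
  have "lo N i = lo i i \<and> mid N i = mid i i"
    using assms by (induction N rule: dec_induct) (simp_all add: slots_Suc_old)
  then show ?thesis using slot_ordered[OF assms] by auto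
qed

lemma rests_disjoint:
  assumes "i \<noteq> j"
  shows "mid i i < lo j j \<or> mid j j < lo i i"
proof -
  have "lo k k \<in> {lo N k..hi N k}" "mid k k \<in> {lo N k..hi N k}" if "k \<le> N" for k N
    using rest_subset_slot[OF that] slot_ordered[of k k] by auto
  from this[of i "max i j"] this[of j "max i j"] show ?thesis
    using slots_disjoint[of i "max i j" j] assms by auto
qed

lemma walk_on_slot: "\<lbrakk>i \<le> N; t \<in> {lo N i..hi N i}\<rbrakk> \<Longrightarrow> walk N t = x i"
proof (induction N arbitrary: i)
  case (Suc N)
  show ?case
  proof (cases "i = Suc N")
    case True
    then show ?thesis
      using Suc.prems parent_slot(2)[of N] path_finish
      by (simp add: slots_Suc_new excursion_rest)
  next
    case False
    then have "i \<le> N" and t: "t \<in> {lo N i..hi N i}"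
      using Suc.prems slot_Suc_subset[of i N] by auto
    then have "t \<le> departure N \<or> return N < t"
      using False Suc.prems slots_disjoint[OF \<open>i \<le> N\<close> par_le] parent_slot[of N]
      by (cases "i = parent N") (auto simp: slots_Suc_old)
    moreover have "departure N \<in> {lo N (parent N)..hi N (parent N)}"
      using parent_slot[of N] by auto
    ultimately show ?thesis
      using Suc.IH[OF \<open>i \<le> N\<close> t] Suc.IH[OF par_le] parent_slot(2)[of N] path_start
      by (cases "t = departure N") (auto simp: excursion_outside excursion_ends)
  qed
qed simp

lemma continuous_map_walk: "continuous_map (top_of_set S) mtopology (walk N)"
proof (induction N)
  case (Suc N)
  have "departure N \<in> {lo N (parent N)..hi N (parent N)}" "return N \<in> {lo N (parent N)..hi N (parent N)}"
    using parent_slot[of N] by auto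
  then show ?case
    unfolding walk.simps
    by (intro continuous_map_excursion parent_slot Suc.IH path)
      (simp_all only: walk_on_slot[OF par_le] path_start)
qed (use x_in in simp)

lemma walk_in: "walk N t \<in> M"
  using continuous_map_funspace[OF continuous_map_walk[of UNIV N]] by auto

lemma path_in: "u \<in> {0..1} \<Longrightarrow> \<gamma> (Suc N) u \<in> M"
  using path[of N] by (auto simp: pathin_def continuous_map_def Pi_iff)

text \<open>Levels increase along nested excursions, so their lengths add up to at most a geometric series.\<close>

lemma excursion_close:
  assumes deep: "\<And>i. N0 < i \<Longrightarrow> m < lev i"
  shows "\<lbrakk>N0 \<le> k; t \<in> {lo k (parent k)..hi k (parent k)}; u \<in> {0..1}\<rbrakk>
    \<Longrightarrow> d (\<gamma> (Suc k) u) (walk N0 t) \<le> 1 / 2 ^ m - 1 / 2 ^ lev (Suc k)"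
proof (induction k arbitrary: u rule: less_induct)
  case (less k)
  have "m < lev (Suc k)" using deep less.prems(1) by simp
  have half: "2 * (1 / 2 ^ lev (Suc k)) \<le> (1 / 2 ^ l :: real)" if "l < lev (Suc k)" for l
  proof -
    have "(2::real) ^ Suc l \<le> 2 ^ lev (Suc k)" using that by (intro power_increasing) auto
    then show ?thesis by (simp add: field_simps)
  qed
  have "d (x (parent k)) (walk N0 t) \<le> 1 / 2 ^ m - 2 * (1 / 2 ^ lev (Suc k))"
  proof (cases "parent k \<le> N0")
    case True
    then have "walk N0 t = x (parent k)"
      using slot_antimono[OF True less.prems(1)] less.prems(2) walk_on_slot by blast
    then show ?thesis using half[OF \<open>m < lev (Suc k)\<close>] x_in by simp
  next
    case False
    then obtain j where j: "parent k = Suc j" "N0 \<le> j" "j < k"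
      using par_le[of k] by (cases "parent k") auto
    have "t \<in> {lo j (parent j)..hi j (parent j)}"
      using less.prems(2) slot_antimono[of "Suc j" "Suc j" k] new_slot_subset[of j] j by auto
    then have "d (x (parent k)) (walk N0 t) \<le> 1 / 2 ^ m - 1 / 2 ^ lev (parent k)"
      using less.IH[of j 1] path_finish[of j] j by simp
    then show ?thesis using half[OF lev_par] \<open>m < lev (Suc k)\<close> by simp
  qed
  moreover have "d (x (parent k)) (\<gamma> (Suc k) u) \<le> 1 / 2 ^ lev (Suc k)"
    using path_close less.prems(3) \<open>m < lev (Suc k)\<close> by simp
  ultimately show ?case
    using triangle[of "\<gamma> (Suc k) u" "x (parent k)" "walk N0 t"] walk_in x_in path_in[OF less.prems(3)]
      commute[of "x (parent k)" "\<gamma> (Suc k) u"] by simp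
qed

lemma walk_close:
  assumes deep: "\<And>i. N0 < i \<Longrightarrow> m < lev i" and "N0 \<le> N"
  shows "d (walk N t) (walk N0 t) \<le> 1 / 2 ^ m"
  using assms(2)
proof (induction N rule: dec_induct)
  case (step N)
  show ?case
  proof (cases "departure N \<le> t \<and> t \<le> return N")
    case True
    then obtain u where u: "u \<in> {0..1}" "walk (Suc N) t = \<gamma> (Suc N) u"
      using excursion_inside[OF parent_slot(2), of N t] by auto
    have "t \<in> {lo N (parent N)..hi N (parent N)}" using True parent_slot[of N] by auto
    then have "d (walk (Suc N) t) (walk N0 t) \<le> 1 / 2 ^ m - 1 / 2 ^ lev (Suc N)"
      using excursion_close[OF deep] step.hyps(1) u by simp
    then show ?thesis by (simp add: order_trans)
  next
    case False
    then show ?thesis using step.IH by (simp add: excursion_outside not_le)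
  qed
qed (use walk_in in simp)

lemma uniformly_Cauchy_walk:
  assumes "0 < \<epsilon>"
  shows "\<exists>N. \<forall>k l t. N \<le> k \<longrightarrow> N \<le> l \<longrightarrow> d (walk k t) (walk l t) < \<epsilon>"
proof -
  obtain m where "2 / \<epsilon> < 2 ^ m" using real_arch_pow[of 2 "2 / \<epsilon>"] by auto
  then have m: "2 / 2 ^ m < \<epsilon>" using assms by (simp add: field_simps)
  obtain N where "\<And>i. lev i \<le> m \<Longrightarrow> i \<le> N"
    using finite_level[of m] finite_nat_set_iff_bounded_le by auto
  then have deep: "m < lev i" if "N < i" for i using that by (meson not_le)
  have "d (walk k t) (walk l t) < \<epsilon>" if "N \<le> k" "N \<le> l" for k l t
    using triangle[of "walk k t" "walk N t" "walk l t"] walk_in commute[of "walk l t" "walk N t"]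
      walk_close[OF deep that(1), of t] walk_close[OF deep that(2), of t] m by simp
  then show ?thesis by blast
qed

lemma limit_walk:
  assumes mcomplete
  obtains \<beta> :: "real \<Rightarrow> 'a" where
    "continuous_map (top_of_set {0..1}) mtopology \<beta>" "\<And>i t. t \<in> {lo i i..mid i i} \<Longrightarrow> \<beta> t = x i"
proof -
  let ?I = "top_of_set {0..1} :: real topology"
  have Cauchy: "\<exists>N. \<forall>k l t. N \<le> k \<longrightarrow> N \<le> l \<longrightarrow> t \<in> topspace ?I \<longrightarrow> d (walk k t) (walk l t) < \<epsilon>" if "0 < \<epsilon>" for \<epsilon>
    using uniformly_Cauchy_walk[OF that] by meson
  obtain \<beta> where \<beta>: "continuous_map ?I mtopology \<beta>"
    and lim: "\<And>\<epsilon>. 0 < \<epsilon> \<Longrightarrow> \<forall>\<^sub>F n in sequentially. \<forall>t\<in>topspace ?I. d (walk n t) (\<beta> t) < \<epsilon>"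
    by (rule continuous_map_uniformly_Cauchy_limit[where f = walk and X = ?I, OF assms _ Cauchy])
      (auto simp add: continuous_map_walk simp del: topspace_euclidean_subtopology)
  have "\<beta> t = x i" if t: "t \<in> {lo i i..mid i i}" for i t
  proof (rule ccontr)
    assume "\<beta> t \<noteq> x i"
    have "t \<in> {0..1}" using t rest_subset_slot[of i i] slot_in_unit[of i i] by auto
    then have "\<beta> t \<in> M" using \<beta> by (auto simp: continuous_map_def Pi_iff)
    with \<open>\<beta> t \<noteq> x i\<close> have "0 < d (x i) (\<beta> t)" using x_in by auto
    then obtain n where "i \<le> n" "d (walk n t) (\<beta> t) < d (x i) (\<beta> t)"
      using eventually_conj[OF lim eventually_ge_at_top[of i]] \<open>t \<in> {0..1}\<close>
      by (fastforce dest: eventually_happens)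
    moreover have "walk n t = x i" using walk_on_slot[OF \<open>i \<le> n\<close>] rest_subset_slot[OF \<open>i \<le> n\<close>] t by blast
    ultimately show False by simp
  qed
  with \<beta> show thesis by (rule that)
qed

end

lemma (in Metric_space) excursion_tree_exists:
  assumes "compact_space mtopology" "connected_space mtopology" "locally_path_connected_space mtopology"
    and "range x \<subseteq> M"
  obtains par lev \<gamma> where "excursion_tree M d x par lev \<gamma>"
proof -
  let ?joins = "\<lambda>\<gamma> p q. pathin mtopology \<gamma> \<and> \<gamma> 0 = p \<and> \<gamma> 1 = q"
  have "\<exists>\<delta>>0. \<forall>p\<in>M. \<forall>q\<in>M. d p q < \<delta> \<longrightarrow> (\<exists>\<gamma>. ?joins \<gamma> p q \<and> (\<forall>u\<in>{0..1}. d p (\<gamma> u) \<le> 1 / 2 ^ m))" for m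
    using uniformly_locally_path_connected[OF assms(1,3), of "1 / 2 ^ m"]
    by (metis zero_less_divide_1_iff zero_less_numeral zero_less_power)
  then obtain \<delta> where \<delta>: "\<And>m. 0 < \<delta> m"
    and short: "\<And>m p q. \<lbrakk>p \<in> M; q \<in> M; d p q < \<delta> m\<rbrakk> \<Longrightarrow> \<exists>\<gamma>. ?joins \<gamma> p q \<and> (\<forall>u\<in>{0..1}. d p (\<gamma> u) \<le> 1 / 2 ^ m)"
    by metis
  have "mtotally_bounded (range x)"
    using assms(1,4) compact_space_eq_mcomplete_mtotally_bounded mtotally_bounded_subset by blast
  then obtain lev par where par: "\<And>j. par (Suc j) \<le> j" "\<And>m. finite {j. lev j \<le> m}"
    "\<And>j. 0 < lev j \<Longrightarrow> lev (par j) < lev j \<and> d (x (par j)) (x j) < \<delta> (lev j)"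
    using close_predecessors[of x \<delta>] \<delta> by metis
  have "path_connected_space mtopology"
    using assms(2,3) path_connected_eq_connected_space by blast
  then have "\<exists>\<gamma>. ?joins \<gamma> (x (par j)) (x j)" for j
    using assms(4) unfolding path_connected_space_def by (auto simp: image_subset_iff)
  then have "\<exists>\<gamma>. ?joins \<gamma> (x (par j)) (x j) \<and>
      (0 < lev j \<longrightarrow> (\<forall>u\<in>{0..1}. d (x (par j)) (\<gamma> u) \<le> 1 / 2 ^ lev j))" for j
    using short[of "x (par j)" "x j" "lev j"] par(3)[of j] assms(4)
    by (cases "0 < lev j") (auto simp: image_subset_iff)
  then obtain \<gamma> where "\<And>j. ?joins (\<gamma> j) (x (par j)) (x j) \<and>
      (0 < lev j \<longrightarrow> (\<forall>u\<in>{0..1}. d (x (par j)) (\<gamma> j u) \<le> 1 / 2 ^ lev j))" by metis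
  then have "excursion_tree M d x par lev \<gamma>"
    by unfold_locales (use assms(4) par in auto)
  then show thesis by (rule that)
qed

proposition peano_continuum_resting_path:
  assumes "peano_continuum X" "y0 \<in> topspace X" "\<And>j. x j \<in> topspace X"
  obtains \<beta> and l r :: "nat \<Rightarrow> real" where
    "continuous_map (top_of_set {0..1}) X \<beta>" "\<beta> 0 = y0"
    "\<And>j. 0 \<le> l j \<and> l j < r j \<and> r j \<le> 1"
    "\<And>j t. t \<in> {l j..r j} \<Longrightarrow> \<beta> t = x j"
    "\<And>i j. i \<noteq> j \<Longrightarrow> r i < l j \<or> r j < l i"
proof -
  have X: "metrizable_space X" "compact_space X" "connected_space X" "locally_path_connected_space X"
    using assms(1) by (simp_all add: peano_continuum_def)
  then obtain M d where "Metric_space M d" and Xeq: "X = Metric_space.mtopology M d"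
    unfolding metrizable_space_def by blast
  interpret Metric_space M d by fact
  define z where "z = case_nat y0 x"
  have "range z \<subseteq> M" using assms(2,3) Xeq by (auto simp: z_def split: nat.split)
  then obtain par lev \<gamma> where "excursion_tree M d z par lev \<gamma>"
    using excursion_tree_exists X(2-4) unfolding Xeq by blast
  then interpret T: excursion_tree M d z par lev \<gamma> .
  have "mcomplete" using X(2) Xeq compact_space_eq_mcomplete_mtotally_bounded by auto
  then obtain \<beta> where \<beta>: "continuous_map (top_of_set {0..1}) X \<beta>"
      "\<And>i t. t \<in> {T.lo i i..T.mid i i} \<Longrightarrow> \<beta> t = z i"
    using T.limit_walk Xeq by metis
  show thesis
  proof (rule that[OF \<beta>(1)])
    show "\<beta> 0 = y0" using \<beta>(2)[of 0 0] by (simp add: z_def)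
    show "0 \<le> T.lo (Suc j) (Suc j) \<and> T.lo (Suc j) (Suc j) < T.mid (Suc j) (Suc j)
        \<and> T.mid (Suc j) (Suc j) \<le> 1" for j
      using T.slot_in_unit[of "Suc j" "Suc j"] T.slot_ordered[of "Suc j" "Suc j"] by auto
    show "\<beta> t = x j" if "t \<in> {T.lo (Suc j) (Suc j)..T.mid (Suc j) (Suc j)}" for j t
      using \<beta>(2)[OF that] by (simp add: z_def)
  qed (use T.rests_disjoint in auto)
qed

section \<open>Homotopy groups\<close>

abbreviation cube_loop :: "nat \<Rightarrow> 'a topology \<Rightarrow> 'a \<Rightarrow> ((nat \<Rightarrow> real) \<Rightarrow> 'a) \<Rightarrow> bool" where
  "cube_loop n Z z f \<equiv> continuous_map (cube n) Z f \<and> f ` cube_bdry n \<subseteq> {z}"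

abbreviation cube_homotopic ::
    "nat \<Rightarrow> 'a topology \<Rightarrow> 'a \<Rightarrow> ((nat \<Rightarrow> real) \<Rightarrow> 'a) \<Rightarrow> ((nat \<Rightarrow> real) \<Rightarrow> 'a) \<Rightarrow> bool" where
  "cube_homotopic n Z z \<equiv> homotopic_with (\<lambda>h. h ` cube_bdry n \<subseteq> {z}) (cube n) Z"

abbreviation homotopy_cube :: "nat \<Rightarrow> (real \<times> (nat \<Rightarrow> real)) topology" where
  "homotopy_cube n \<equiv> prod_topology (top_of_set {0..1}) (cube n)"

lemma topspace_cube: "topspace (cube n) = ({..<n} \<rightarrow>\<^sub>E {0..1})"
  by (simp add: cube_def)

lemma cube_coord_bounds: "\<lbrakk>t \<in> topspace (cube n); i < n\<rbrakk> \<Longrightarrow> 0 \<le> t i \<and> t i \<le> 1"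
  by (auto simp: topspace_cube PiE_iff)

lemma cube_extensional: "t \<in> topspace (cube n) \<Longrightarrow> t \<in> extensional {..<n}"
  by (simp add: topspace_cube PiE_iff)

lemma in_cubeI:
  "\<lbrakk>t \<in> extensional {..<n}; \<And>i. i < n \<Longrightarrow> 0 \<le> t i \<and> t i \<le> 1\<rbrakk> \<Longrightarrow> t \<in> topspace (cube n)"
  by (auto simp: topspace_cube PiE_iff)

lemma cube_bdry_in_cube: "t \<in> cube_bdry n \<Longrightarrow> t \<in> topspace (cube n)"
  by (simp add: cube_bdry_def)

lemma in_cube_bdryI: "\<lbrakk>t \<in> topspace (cube n); i < n; t i = 0 \<or> t i = 1\<rbrakk> \<Longrightarrow> t \<in> cube_bdry n"
  by (auto simp: cube_bdry_def)

lemma in_cube_bdryE: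
  assumes "t \<in> cube_bdry n"
  obtains i where "i < n" "t i = 0 \<or> t i = 1"
  using assms by (auto simp: cube_bdry_def)

lemma cube_upd_in_cube:
  "\<lbrakk>t \<in> topspace (cube n); i < n; 0 \<le> u; u \<le> 1\<rbrakk> \<Longrightarrow> t(i := u) \<in> topspace (cube n)"
  by (auto simp: topspace_cube PiE_iff extensional_def)

lemma cube_upd_in_bdry:
  assumes "t \<in> cube_bdry n" "i < n" "0 \<le> u" "u \<le> 1" "t i = 0 \<or> t i = 1 \<Longrightarrow> u = 0 \<or> u = 1"
  shows "t(i := u) \<in> cube_bdry n"
proof -
  have upd: "t(i := u) \<in> topspace (cube n)"
    using assms by (intro cube_upd_in_cube cube_bdry_in_cube)
  obtain k where "k < n" "t k = 0 \<or> t k = 1" using assms(1) by (rule in_cube_bdryE)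
  then show ?thesis using assms(5) in_cube_bdryI[OF upd, of k] by (cases "k = i") auto
qed

lemma cube_face_in_bdry:
  "\<lbrakk>t \<in> topspace (cube n); i < n; u = 0 \<or> u = 1\<rbrakk> \<Longrightarrow> t(i := u) \<in> cube_bdry n"
  by (rule in_cube_bdryI[where i = i]) (auto intro: cube_upd_in_cube)

lemma continuous_map_into_cube:
  assumes "\<And>p. p \<in> topspace T \<Longrightarrow> F p \<in> extensional {..<n}"
    and "\<And>i. i < n \<Longrightarrow> continuous_map T (top_of_set {0..1}) (\<lambda>p. F p i)"
  shows "continuous_map T (cube n) F"
  using assms by (auto simp: cube_def continuous_map_componentwise)

lemma continuous_map_cube_coord:
  assumes "continuous_map T (cube n) F" "i < n"
  shows "continuous_map T (top_of_set {0..1}) (\<lambda>p. F p i)"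
  using assms by (auto simp: cube_def continuous_map_componentwise)

lemma continuous_map_cube_upd:
  assumes F: "continuous_map T (cube n) F" and "i < n" and u: "continuous_map T (top_of_set {0..1}) u"
  shows "continuous_map T (cube n) (\<lambda>p. (F p)(i := u p))"
proof (rule continuous_map_into_cube)
  show "(F p)(i := u p) \<in> extensional {..<n}" if "p \<in> topspace T" for p
    using cube_extensional[OF funcset_mem[OF continuous_map_funspace[OF F] that]] \<open>i < n\<close>
    by (auto simp: extensional_def)
  show "continuous_map T (top_of_set {0..1}) (\<lambda>p. ((F p)(i := u p)) k)" if "k < n" for k
    using continuous_map_cube_coord[OF F that] u by (cases "k = i") auto
qed

lemma continuous_map_homotopy_time: "continuous_map (homotopy_cube n) (top_of_set {0..1}) fst"
  by (simp add: continuous_map_fst)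

lemma continuous_map_homotopy_point: "continuous_map (homotopy_cube n) (cube n) snd"
  by (simp add: continuous_map_snd)

lemma continuous_map_homotopy_coord:
  "i < n \<Longrightarrow> continuous_map (homotopy_cube n) (top_of_set {0..1}) (\<lambda>p. snd p i)"
  by (rule continuous_map_cube_coord[OF continuous_map_homotopy_point])

lemma cube_homotopicI:
  assumes "continuous_map (homotopy_cube n) Z h"
    and "\<And>t. t \<in> topspace (cube n) \<Longrightarrow> h (0, t) = f t"
    and "\<And>t. t \<in> topspace (cube n) \<Longrightarrow> h (1, t) = g t"
    and "\<And>s t. \<lbrakk>0 \<le> s; s \<le> 1; t \<in> cube_bdry n\<rbrakk> \<Longrightarrow> h (s, t) = z"
  shows "cube_homotopic n Z z f g"
proof -
  have "(h ` cube_bdry n \<subseteq> {z}) = (k ` cube_bdry n \<subseteq> {z})"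
    if "\<And>t. t \<in> topspace (cube n) \<Longrightarrow> h t = k t" for h k :: "_ \<Rightarrow> 'a"
    using that cube_bdry_in_cube by (metis image_cong)
  from homotopic_with[where P = "\<lambda>h. h ` cube_bdry n \<subseteq> {z}", OF this]
  show ?thesis using assms by (auto intro!: exI[of _ h])
qed

lemma cube_homotopicE:
  assumes "cube_homotopic n Z z f g"
  obtains h where "continuous_map (homotopy_cube n) Z h" "\<And>t. h (0, t) = f t" "\<And>t. h (1, t) = g t"
    "\<And>s t. \<lbrakk>0 \<le> s; s \<le> 1; t \<in> cube_bdry n\<rbrakk> \<Longrightarrow> h (s, t) = z"
  using assms unfolding homotopic_with_def image_subset_iff by (metis atLeastAtMost_iff singletonD)

lemma cube_homotopic_cong:
  assumes "cube_homotopic n Z z f g"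
    and "\<And>t. t \<in> topspace (cube n) \<Longrightarrow> f' t = f t" "\<And>t. t \<in> topspace (cube n) \<Longrightarrow> g' t = g t"
  shows "cube_homotopic n Z z f' g'"
proof -
  obtain h where "continuous_map (homotopy_cube n) Z h" "\<And>t. h (0, t) = f t" "\<And>t. h (1, t) = g t"
    "\<And>s t. \<lbrakk>0 \<le> s; s \<le> 1; t \<in> cube_bdry n\<rbrakk> \<Longrightarrow> h (s, t) = z"
    using cube_homotopicE[OF assms(1)] by blast
  then show ?thesis using assms(2,3) by (intro cube_homotopicI[of n Z h]) auto
qed

lemma cube_homotopic_imp_loops:
  assumes "cube_homotopic n Z z f g"
  shows "cube_loop n Z z f" "cube_loop n Z z g"
  using homotopic_with_imp_continuous_maps[OF assms] homotopic_with_imp_property[OF assms] by simp_all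

lemma cube_loop_bdry: "\<lbrakk>cube_loop n Z z f; t \<in> cube_bdry n\<rbrakk> \<Longrightarrow> f t = z"
  by blast

lemma cube_homotopic_precompose:
  assumes f: "cube_loop n Z z f" and \<phi>: "continuous_map (homotopy_cube n) (cube n) \<phi>"
    and bdry: "\<And>s t. \<lbrakk>0 \<le> s; s \<le> 1; t \<in> cube_bdry n\<rbrakk> \<Longrightarrow> \<phi> (s, t) \<in> cube_bdry n"
  shows "cube_homotopic n Z z (\<lambda>t. f (\<phi> (0, t))) (\<lambda>t. f (\<phi> (1, t)))"
proof (rule cube_homotopicI)
  show "continuous_map (homotopy_cube n) Z (\<lambda>p. f (\<phi> p))"
    using continuous_map_compose[OF \<phi> conjunct1[OF f]] by (simp add: o_def)
qed (use bdry cube_loop_bdry[OF f] in auto)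

definition interval_reparam :: "(real \<Rightarrow> real) \<Rightarrow> bool" where
  "interval_reparam e \<longleftrightarrow> continuous_on {0..1} e \<and> e ` {0..1} \<subseteq> {0..1} \<and> e 0 \<in> {0, 1} \<and> e 1 \<in> {0, 1}"

lemma interval_reparamI:
  assumes "continuous_on {0..1} e" "\<And>u. \<lbrakk>0 \<le> u; u \<le> 1\<rbrakk> \<Longrightarrow> 0 \<le> e u \<and> e u \<le> 1"
    "e 0 = 0 \<or> e 0 = 1" "e 1 = 0 \<or> e 1 = 1"
  shows "interval_reparam e"
  using assms by (simp add: interval_reparam_def image_subset_iff)

lemma interval_reparam_id: "interval_reparam (\<lambda>u. u)"
  by (simp add: interval_reparam_def)

lemma interval_reparam_const: "c = 0 \<or> c = 1 \<Longrightarrow> interval_reparam (\<lambda>u. c)"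
  by (auto simp: interval_reparam_def)

definition interpolate :: "(real \<Rightarrow> real) \<Rightarrow> (real \<Rightarrow> real) \<Rightarrow> real \<Rightarrow> real \<Rightarrow> real" where
  "interpolate e e' s u = (1 - s) * e u + s * e' u"

lemma interpolate_ends [simp]: "interpolate e e' 0 = e" "interpolate e e' 1 = e'"
  by (simp_all add: interpolate_def fun_eq_iff)

lemma interpolate_agree: "e u = e' u \<Longrightarrow> interpolate e e' s u = e u"
  by (simp add: interpolate_def algebra_simps)

lemma continuous_map_interpolate:
  assumes "interval_reparam e" "interval_reparam e'"
    and s: "continuous_map T (top_of_set {0..1}) s" and u: "continuous_map T (top_of_set {0..1}) u"
  shows "continuous_map T (top_of_set {0..1}) (\<lambda>p. interpolate e e' (s p) (u p))"
proof (rule continuous_map_into_subtopology)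
  have "continuous_map T euclideanreal (\<lambda>p. f (u p))" if "interval_reparam f" for f
    using continuous_map_compose[OF u, of euclideanreal f] that by (simp add: interval_reparam_def o_def)
  then show "continuous_map T euclideanreal (\<lambda>p. interpolate e e' (s p) (u p))"
    unfolding interpolate_def using assms continuous_map_into_fulltopology[OF s]
    by (intro continuous_map_add continuous_map_real_mult continuous_map_diff) auto
  have "interpolate e e' (s p) (u p) \<in> {0..1}" if "p \<in> topspace T" for p
  proof -
    have su: "s p \<in> {0..1}" "u p \<in> {0..1}"
      using funcset_mem[OF continuous_map_funspace[OF s] that]
        funcset_mem[OF continuous_map_funspace[OF u] that]
      by simp_all
    then have "e (u p) \<in> {0..1}" "e' (u p) \<in> {0..1}"
      using assms(1,2) by (auto simp only: interval_reparam_def image_subset_iff)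
    then show ?thesis
      using su convex_bound_le[of "e (u p)" 1 "e' (u p)" "1 - s p" "s p"] by (simp add: interpolate_def)
  qed
  then show "(\<lambda>p. interpolate e e' (s p) (u p)) \<in> topspace T \<rightarrow> {0..1}" by blast
qed

lemma cube_homotopic_reparametrize:
  assumes f: "cube_loop n Z z f"
    and e: "\<And>i. i < n \<Longrightarrow> interval_reparam (e i)" "\<And>i. i < n \<Longrightarrow> interval_reparam (e' i)"
    and ends: "\<And>i. i < n \<Longrightarrow> e i 0 = e' i 0 \<and> e i 1 = e' i 1"
  shows "cube_homotopic n Z z (\<lambda>t. f (\<lambda>i\<in>{..<n}. e i (t i))) (\<lambda>t. f (\<lambda>i\<in>{..<n}. e' i (t i)))"
proof -
  define \<phi> where "\<phi> = (\<lambda>p. \<lambda>i\<in>{..<n}. interpolate (e i) (e' i) (fst p) (snd p i))"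
  have \<phi>: "continuous_map (homotopy_cube n) (cube n) \<phi>"
  proof (rule continuous_map_into_cube)
    fix i assume "i < n"
    then show "continuous_map (homotopy_cube n) (top_of_set {0..1}) (\<lambda>p. \<phi> p i)"
      using continuous_map_interpolate[OF e continuous_map_homotopy_time continuous_map_homotopy_coord]
      by (simp add: \<phi>_def)
  qed (simp add: \<phi>_def)
  moreover have "\<phi> (s, t) \<in> cube_bdry n" if st: "0 \<le> s" "s \<le> 1" "t \<in> cube_bdry n" for s t
  proof -
    obtain i where i: "i < n" "t i = 0 \<or> t i = 1" using st(3) by (rule in_cube_bdryE)
    then have "\<phi> (s, t) i = e i (t i)" using ends[OF i(1)] by (auto simp: \<phi>_def interpolate_agree)
    moreover have "e i (t i) \<in> {0, 1}" using e(1)[OF i(1)] i(2) by (auto simp: interval_reparam_def)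
    moreover have "\<phi> (s, t) \<in> topspace (cube n)"
      using funcset_mem[OF continuous_map_funspace[OF \<phi>], of "(s, t)"] cube_bdry_in_cube[OF st(3)] st
      by simp
    ultimately show ?thesis using i(1) by (intro in_cube_bdryI[of _ _ i]) auto
  qed
  ultimately show ?thesis using cube_homotopic_precompose[OF f, of \<phi>] by (simp add: \<phi>_def)
qed

lemma cube_homotopic_reparametrize_coord:
  assumes f: "cube_loop n Z z f" and "i < n"
    and e: "interval_reparam e" "interval_reparam e'" "e 0 = e' 0" "e 1 = e' 1"
  shows "cube_homotopic n Z z (\<lambda>t. f (t(i := e (t i)))) (\<lambda>t. f (t(i := e' (t i))))"
proof (rule cube_homotopic_cong)
  let ?at = "\<lambda>e k. if k = i then e else (\<lambda>u. u)"
  show "cube_homotopic n Z z (\<lambda>t. f (\<lambda>k\<in>{..<n}. ?at e k (t k))) (\<lambda>t. f (\<lambda>k\<in>{..<n}. ?at e' k (t k)))"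
    using e interval_reparam_id by (intro cube_homotopic_reparametrize[OF f]) auto
  have coord: "t(i := e (t i)) = (\<lambda>k\<in>{..<n}. ?at e k (t k))" if "t \<in> topspace (cube n)" for t e
    using cube_extensional[OF that] \<open>i < n\<close> by (auto simp: fun_eq_iff extensional_def)
  show "f (t(i := e (t i))) = f (\<lambda>k\<in>{..<n}. ?at e k (t k))"
    "f (t(i := e' (t i))) = f (\<lambda>k\<in>{..<n}. ?at e' k (t k))" if "t \<in> topspace (cube n)" for t
    by (simp_all only: coord[OF that, of e] coord[OF that, of e'])
qed

text \<open>The group operation concatenates in direction \<open>0\<close>; the other directions are needed for commutativity.\<close>

definition cube_concat_along ::
    "nat \<Rightarrow> ((nat \<Rightarrow> real) \<Rightarrow> 'a) \<Rightarrow> ((nat \<Rightarrow> real) \<Rightarrow> 'a) \<Rightarrow> (nat \<Rightarrow> real) \<Rightarrow> 'a" where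
  "cube_concat_along i f g = (\<lambda>t. if t i \<le> 1/2 then f (t(i := 2 * t i)) else g (t(i := 2 * t i - 1)))"

lemma cube_concat_eq_along: "cube_concat = cube_concat_along 0"
  by (simp add: cube_concat_def cube_concat_along_def fun_eq_iff)

lemma cube_concat_along_upper_half:
  assumes "cube_loop n Z z f" "cube_loop n Z z g" "t \<in> topspace (cube n)" "i < n" "1/2 \<le> t i"
  shows "cube_concat_along i f g t = g (t(i := 2 * t i - 1))"
proof (cases "t i = 1/2")
  case True
  have "f (t(i := 1)) = z" "g (t(i := 0)) = z"
    using cube_loop_bdry[OF assms(1)] cube_loop_bdry[OF assms(2)] cube_face_in_bdry[OF assms(3,4)]
    by simp_all
  then show ?thesis by (simp add: cube_concat_along_def True)
qed (use assms in \<open>simp add: cube_concat_along_def\<close>)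

lemma cube_concat_along_bdry:
  assumes f: "\<And>t. t \<in> cube_bdry n \<Longrightarrow> f t = z" and g: "\<And>t. t \<in> cube_bdry n \<Longrightarrow> g t = z"
    and "i < n" "t \<in> cube_bdry n"
  shows "cube_concat_along i f g t = z"
proof -
  have ti: "0 \<le> t i" "t i \<le> 1" using cube_coord_bounds[OF cube_bdry_in_cube] assms by auto
  have "t(i := 2 * t i) \<in> cube_bdry n" if "t i \<le> 1/2"
    using that ti assms by (intro cube_upd_in_bdry) auto
  moreover have "t(i := 2 * t i - 1) \<in> cube_bdry n" if "\<not> t i \<le> 1/2"
    using that ti assms by (intro cube_upd_in_bdry) auto
  ultimately show ?thesis using f g by (simp add: cube_concat_along_def)
qed

lemma cube_concat_along_wall:
  assumes f: "cube_loop n Z z f" and g: "cube_loop n Z z g"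
    and t: "t \<in> topspace (cube n)" "i < n" "t i \<in> {0, 1/2, 1}"
  shows "cube_concat_along i f g t = z"
proof (cases "t i = 1/2")
  case True
  have "cube_concat_along i f g t = g (t(i := 0))"
    using cube_concat_along_upper_half[OF f g t(1,2)] by (simp add: True)
  then show ?thesis using cube_loop_bdry[OF g cube_face_in_bdry[OF t(1,2)]] by simp
next
  case False
  then have "t \<in> cube_bdry n" using in_cube_bdryI[OF t(1,2)] t(3) by auto
  then show ?thesis using cube_concat_along_bdry[of n f z g] cube_loop_bdry f g t(2) by metis
qed

lemma continuous_map_concat_along:
  assumes h: "continuous_map (homotopy_cube n) Z h" "\<And>s t. \<lbrakk>0 \<le> s; s \<le> 1; t \<in> cube_bdry n\<rbrakk> \<Longrightarrow> h (s, t) = z"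
    and k: "continuous_map (homotopy_cube n) Z k" "\<And>s t. \<lbrakk>0 \<le> s; s \<le> 1; t \<in> cube_bdry n\<rbrakk> \<Longrightarrow> k (s, t) = z"
    and "i < n"
  shows "continuous_map (homotopy_cube n) Z
    (\<lambda>p. cube_concat_along i (\<lambda>t. h (fst p, t)) (\<lambda>t. k (fst p, t)) (snd p))"
  unfolding cube_concat_along_def
proof (rule continuous_map_cases_le)
  let ?T = "homotopy_cube n"
  have coord: "continuous_map ?T euclideanreal (\<lambda>p. snd p i)"
    by (rule continuous_map_into_fulltopology[OF continuous_map_homotopy_coord[OF \<open>i < n\<close>]])
  then show "continuous_map ?T euclideanreal (\<lambda>p. snd p i)" .
  have rescaled: "continuous_map (subtopology ?T S) Z (\<lambda>p. h (fst p, (snd p)(i := c * snd p i - b)))"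
    if "continuous_map ?T Z h" "\<And>p. \<lbrakk>p \<in> topspace ?T; p \<in> S\<rbrakk> \<Longrightarrow> c * snd p i - b \<in> {0..1}"
    for h S and c b :: real
  proof -
    have "continuous_map (subtopology ?T S) (top_of_set {0..1}) (\<lambda>p. c * snd p i - b)"
      using that(2) coord
      by (intro continuous_map_into_subtopology)
        (auto intro!: continuous_intros continuous_map_from_subtopology)
    from continuous_map_cube_upd[OF continuous_map_from_subtopology[OF continuous_map_homotopy_point] \<open>i < n\<close> this]
    have "continuous_map (subtopology ?T S) ?T (\<lambda>p. (fst p, (snd p)(i := c * snd p i - b)))"
      by (intro continuous_map_pairedI continuous_map_from_subtopology[OF continuous_map_homotopy_time])
    from continuous_map_compose[OF this that(1)] show ?thesis by (simp add: o_def)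
  qed
  have bounds: "0 \<le> snd p i \<and> snd p i \<le> 1" if "p \<in> topspace ?T" for p
    using cube_coord_bounds[of "snd p" n i] that \<open>i < n\<close> by auto
  show "continuous_map (subtopology ?T {p \<in> topspace ?T. snd p i \<le> 1/2}) Z
      (\<lambda>p. h (fst p, (snd p)(i := 2 * snd p i)))"
    using rescaled[OF h(1), of "{p \<in> topspace ?T. snd p i \<le> 1/2}" 2 0] bounds by simp
  show "continuous_map (subtopology ?T {p \<in> topspace ?T. 1/2 \<le> snd p i}) Z
      (\<lambda>p. k (fst p, (snd p)(i := 2 * snd p i - 1)))"
    using rescaled[OF k(1), of "{p \<in> topspace ?T. 1/2 \<le> snd p i}" 2 1] bounds by simp
  fix p assume p: "p \<in> topspace ?T" "snd p i = 1/2"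
  then have double: "2 * snd p i = 1" by simp
  have "(snd p)(i := 1) \<in> cube_bdry n" "(snd p)(i := 0) \<in> cube_bdry n"
    using p(1) \<open>i < n\<close> by (auto intro!: cube_face_in_bdry)
  then show "h (fst p, (snd p)(i := 2 * snd p i)) = k (fst p, (snd p)(i := 2 * snd p i - 1))"
    unfolding double using p(1) h(2)[of "fst p"] k(2)[of "fst p"] by (auto simp: mem_Times_iff)
qed simp

lemma cube_homotopic_concat_along:
  assumes "cube_homotopic n Z z f f'" "cube_homotopic n Z z g g'" "i < n"
  shows "cube_homotopic n Z z (cube_concat_along i f g) (cube_concat_along i f' g')"
proof -
  obtain h where h: "continuous_map (homotopy_cube n) Z h" "\<And>t. h (0, t) = f t" "\<And>t. h (1, t) = f' t"
    "\<And>s t. \<lbrakk>0 \<le> s; s \<le> 1; t \<in> cube_bdry n\<rbrakk> \<Longrightarrow> h (s, t) = z"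
    using cube_homotopicE[OF assms(1)] by blast
  obtain k where k: "continuous_map (homotopy_cube n) Z k" "\<And>t. k (0, t) = g t" "\<And>t. k (1, t) = g' t"
    "\<And>s t. \<lbrakk>0 \<le> s; s \<le> 1; t \<in> cube_bdry n\<rbrakk> \<Longrightarrow> k (s, t) = z"
    using cube_homotopicE[OF assms(2)] by blast
  show ?thesis
    by (rule cube_homotopicI[OF continuous_map_concat_along[OF h(1,4) k(1,4) \<open>i < n\<close>]])
      (auto simp: h k intro!: cube_concat_along_bdry \<open>i < n\<close>)
qed

lemma cube_loop_concat_along:
  "\<lbrakk>cube_loop n Z z f; cube_loop n Z z g; i < n\<rbrakk> \<Longrightarrow> cube_loop n Z z (cube_concat_along i f g)"
  using cube_homotopic_concat_along[where f = f and f' = f and g = g and g' = g]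
  by (simp only: homotopic_with_refl)

lemma cube_homotopic_concat_const:
  assumes f: "cube_loop n Z z f" and "i < n"
  shows "cube_homotopic n Z z (cube_concat_along i f (\<lambda>t. z)) f" (is ?right)
    and "cube_homotopic n Z z (cube_concat_along i (\<lambda>t. z) f) f" (is ?left)
proof -
  have face: "f (t(i := u)) = z" if "t \<in> topspace (cube n)" "u = 0 \<or> u = 1" for t u
    using cube_loop_bdry[OF f cube_face_in_bdry] that \<open>i < n\<close> by simp
  have "interval_reparam (\<lambda>u. min 1 (2 * u))"
    by (rule interval_reparamI) (auto intro!: continuous_intros)
  then have "cube_homotopic n Z z (\<lambda>t. f (t(i := min 1 (2 * t i)))) (\<lambda>t. f (t(i := t i)))"
    using interval_reparam_id by (intro cube_homotopic_reparametrize_coord[OF f \<open>i < n\<close>]) auto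
  then show ?right
    by (rule cube_homotopic_cong) (auto simp: cube_concat_along_def face min_def)
  have "interval_reparam (\<lambda>u. max 0 (2 * u - 1))"
    by (rule interval_reparamI) (auto intro!: continuous_intros)
  then have "cube_homotopic n Z z (\<lambda>t. f (t(i := max 0 (2 * t i - 1)))) (\<lambda>t. f (t(i := t i)))"
    using interval_reparam_id by (intro cube_homotopic_reparametrize_coord[OF f \<open>i < n\<close>]) auto
  then show ?left
    by (rule cube_homotopic_cong) (auto simp: cube_concat_along_def face max_def)
qed

lemma cube_homotopic_concat_assoc:
  assumes "cube_loop n Z z f" "cube_loop n Z z g" "cube_loop n Z z h" "i < n"
  shows "cube_homotopic n Z z (cube_concat_along i (cube_concat_along i f g) h)
    (cube_concat_along i f (cube_concat_along i g h))"
proof -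
  let ?fgh = "cube_concat_along i f (cube_concat_along i g h)"
  let ?e = "\<lambda>u::real. min (2 * u) (min (u + 1/4) ((u + 1) / 2))"
  have "interval_reparam ?e"
    by (rule interval_reparamI) (auto simp: min_le_iff_disj intro!: continuous_intros)
  then have "cube_homotopic n Z z (\<lambda>t. ?fgh (t(i := ?e (t i)))) (\<lambda>t. ?fgh (t(i := t i)))"
    using assms interval_reparam_id
    by (intro cube_homotopic_reparametrize_coord cube_loop_concat_along) auto
  then show ?thesis
    by (rule cube_homotopic_cong)
      (auto simp: cube_concat_along_def min_def field_simps, simp_all add: diff_divide_distrib mult.commute)
qed

lemma cube_homotopic_concat_inverse:
  assumes f: "cube_loop n Z z f" and "i < n"
  shows "cube_homotopic n Z z (cube_concat_along i (\<lambda>t. f (t(i := 1 - t i))) f) (\<lambda>t. z)"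
proof (rule cube_homotopic_cong)
  have "interval_reparam (\<lambda>u. \<bar>1 - 2 * u\<bar>)"
    by (rule interval_reparamI) (auto intro!: continuous_intros)
  then show "cube_homotopic n Z z (\<lambda>t. f (t(i := \<bar>1 - 2 * t i\<bar>))) (\<lambda>t. f (t(i := 1)))"
    using interval_reparam_const by (intro cube_homotopic_reparametrize_coord[OF f \<open>i < n\<close>]) auto
  show "z = f (t(i := 1))" if "t \<in> topspace (cube n)" for t
    using cube_loop_bdry[OF f cube_face_in_bdry[OF that \<open>i < n\<close>]] by simp
qed (auto simp: cube_concat_along_def)

lemma cube_loop_reverse:
  assumes f: "cube_loop n Z z f" and "i < n"
  shows "cube_loop n Z z (\<lambda>t. f (t(i := 1 - t i)))"
proof -
  have "interval_reparam (\<lambda>u. 1 - u)" by (rule interval_reparamI) (auto intro!: continuous_intros)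
  then show ?thesis
    using cube_homotopic_imp_loops(1)[OF cube_homotopic_reparametrize_coord[OF f \<open>i < n\<close>]] by simp
qed

lemma cube_concat_along_interchange:
  assumes "i \<noteq> j"
  shows "cube_concat_along i (cube_concat_along j f g) (cube_concat_along j h k) =
    cube_concat_along j (cube_concat_along i f h) (cube_concat_along i g k)"
  using assms by (auto simp: cube_concat_along_def fun_eq_iff fun_upd_twist)

text \<open>Eckmann--Hilton: pad both factors by constant maps in direction \<open>j\<close> and interchange.\<close>

lemma cube_homotopic_concat_directions:
  assumes f: "cube_loop n Z z f" and g: "cube_loop n Z z g" and ij: "i < n" "j < n" "i \<noteq> j"
  shows "cube_homotopic n Z z (cube_concat_along i f g) (cube_concat_along j f g)" (is ?same)
    and "cube_homotopic n Z z (cube_concat_along i f g) (cube_concat_along j g f)" (is ?swapped)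
proof -
  note unit = cube_homotopic_concat_const
  note expand = cube_homotopic_concat_along[OF homotopic_with_symD homotopic_with_symD ij(1)]
  note contract = cube_homotopic_concat_along[OF _ _ ij(2)]
  have "cube_homotopic n Z z (cube_concat_along i f g)
      (cube_concat_along i (cube_concat_along j f (\<lambda>t. z)) (cube_concat_along j (\<lambda>t. z) g))"
    by (intro expand unit f g ij)
  then show ?same
    unfolding cube_concat_along_interchange[OF ij(3)]
    by (rule homotopic_with_trans) (intro contract unit f g ij)
  have "cube_homotopic n Z z (cube_concat_along i f g)
      (cube_concat_along i (cube_concat_along j (\<lambda>t. z) f) (cube_concat_along j g (\<lambda>t. z)))"
    by (intro expand unit f g ij)
  then show ?swapped
    unfolding cube_concat_along_interchange[OF ij(3)]
    by (rule homotopic_with_trans) (intro contract unit f g ij)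
qed

lemma cube_homotopic_concat_commute:
  assumes "cube_loop n Z z f" "cube_loop n Z z g" "i < n" "2 \<le> n"
  shows "cube_homotopic n Z z (cube_concat_along i f g) (cube_concat_along i g f)"
proof -
  obtain j where "j < n" "i \<noteq> j" using assms(3,4) that[of "if i = 0 then 1 else 0"] by auto
  then show ?thesis
    using cube_homotopic_concat_directions(1)[OF assms(1,2,3)]
      cube_homotopic_concat_directions(2)[OF assms(2,1,3)]
    by (blast intro: homotopic_with_trans homotopic_with_symD)
qed

lemma hclass_eqI: "cube_homotopic n Z z f g \<Longrightarrow> hclass n Z z f = hclass n Z z g"
  unfolding hclass_def by (blast intro: homotopic_with_trans homotopic_with_symD)

lemma hclass_eq_iff:
  assumes "cube_loop n Z z f"
  shows "hclass n Z z f = hclass n Z z g \<longleftrightarrow> cube_homotopic n Z z f g"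
proof
  assume eq: "hclass n Z z f = hclass n Z z g"
  have "f \<in> hclass n Z z f" using assms by (simp add: hclass_def)
  then show "cube_homotopic n Z z f g" using eq by (auto simp: hclass_def homotopic_with_sym)
qed (rule hclass_eqI)

lemma hclass_in_carrier: "cube_loop n Z z f \<Longrightarrow> hclass n Z z f \<in> carrier (homotopy_group n Z z)"
  by (auto simp: homotopy_group_def)

lemma in_homotopy_groupE:
  assumes "C \<in> carrier (homotopy_group n Z z)"
  obtains f where "cube_loop n Z z f" "C = hclass n Z z f"
  using assms by (auto simp: homotopy_group_def)

lemma homotopy_group_representative:
  assumes "C \<in> carrier (homotopy_group n Z z)"
  shows "cube_loop n Z z (SOME f. f \<in> C)" "hclass n Z z (SOME f. f \<in> C) = C"
proof -
  obtain f where f: "cube_loop n Z z f" "C = hclass n Z z f" using assms by (rule in_homotopy_groupE)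
  then have "f \<in> C" by (simp add: hclass_def)
  then have "(SOME f. f \<in> C) \<in> C" by (rule someI[of "\<lambda>f. f \<in> C"])
  then have homotopic: "cube_homotopic n Z z f (SOME f. f \<in> C)" using f by (simp add: hclass_def)
  show "cube_loop n Z z (SOME f. f \<in> C)" by (rule cube_homotopic_imp_loops(2)[OF homotopic])
  show "hclass n Z z (SOME f. f \<in> C) = C" using hclass_eqI[OF homotopic] f(2) by simp
qed

lemma in_product_homotopy_groupE:
  assumes "D \<in> carrier (product_group UNIV (\<lambda>j. homotopy_group n (Z j) (z j)))"
  obtains g where "\<And>j. cube_loop n (Z j) (z j) (g j)" "D = (\<lambda>j. hclass n (Z j) (z j) (g j))"
proof (rule that[of "\<lambda>j. SOME g. g \<in> D j"])
  have D: "D j \<in> carrier (homotopy_group n (Z j) (z j))" for j using assms by (auto simp: PiE_UNIV_domain)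
  show "cube_loop n (Z j) (z j) (SOME g. g \<in> D j)" for j
    by (rule homotopy_group_representative(1)[OF D])
  show "D = (\<lambda>j. hclass n (Z j) (z j) (SOME g. g \<in> D j))"
    by (simp only: homotopy_group_representative(2)[OF D])
qed

lemma hclass_representative_homotopic:
  assumes "cube_loop n Z z f"
  shows "cube_homotopic n Z z f (SOME g. g \<in> hclass n Z z f)"
  using hclass_eq_iff[OF assms] homotopy_group_representative(2)[OF hclass_in_carrier[OF assms]] by metis

lemma hclass_mult:
  assumes "cube_loop n Z z f" "cube_loop n Z z g" "0 < n"
  shows "hclass n Z z f \<otimes>\<^bsub>homotopy_group n Z z\<^esub> hclass n Z z g = hclass n Z z (cube_concat_along 0 f g)"
  unfolding homotopy_group_def monoid.simps cube_concat_eq_along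
  by (rule hclass_eqI[symmetric])
    (intro cube_homotopic_concat_along hclass_representative_homotopic assms)

lemma one_homotopy_group: "\<one>\<^bsub>homotopy_group n Z z\<^esub> = hclass n Z z (\<lambda>t. z)"
  by (simp add: homotopy_group_def)

lemma cube_loop_const: "z \<in> topspace Z \<Longrightarrow> cube_loop n Z z (\<lambda>t. z)"
  by auto

theorem group_homotopy_group:
  assumes "0 < n" "z \<in> topspace Z"
  shows "group (homotopy_group n Z z)"
proof (rule groupI)
  let ?\<pi> = "homotopy_group n Z z"
  note const = cube_loop_const[OF assms(2)]
  show "\<one>\<^bsub>?\<pi>\<^esub> \<in> carrier ?\<pi>" unfolding one_homotopy_group by (rule hclass_in_carrier[OF const])
  fix C assume "C \<in> carrier ?\<pi>"
  then obtain f where f: "cube_loop n Z z f" "C = hclass n Z z f" by (rule in_homotopy_groupE)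
  show "\<one>\<^bsub>?\<pi>\<^esub> \<otimes>\<^bsub>?\<pi>\<^esub> C = C"
    unfolding one_homotopy_group f(2) hclass_mult[OF const f(1) assms(1)]
    by (rule hclass_eqI[OF cube_homotopic_concat_const(2)[OF f(1) assms(1)]])
  note reverse = cube_loop_reverse[OF f(1) assms(1)]
  have "hclass n Z z (\<lambda>t. f (t(0 := 1 - t 0))) \<otimes>\<^bsub>?\<pi>\<^esub> C = \<one>\<^bsub>?\<pi>\<^esub>"
    unfolding one_homotopy_group f(2) hclass_mult[OF reverse f(1) assms(1)]
    by (rule hclass_eqI[OF cube_homotopic_concat_inverse[OF f(1) assms(1)]])
  then show "\<exists>D\<in>carrier ?\<pi>. D \<otimes>\<^bsub>?\<pi>\<^esub> C = \<one>\<^bsub>?\<pi>\<^esub>" using hclass_in_carrier[OF reverse] by blast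
  fix D assume "D \<in> carrier ?\<pi>"
  then obtain g where g: "cube_loop n Z z g" "D = hclass n Z z g" by (rule in_homotopy_groupE)
  note fg = cube_loop_concat_along[OF f(1) g(1) assms(1)]
  show "C \<otimes>\<^bsub>?\<pi>\<^esub> D \<in> carrier ?\<pi>"
    unfolding f(2) g(2) hclass_mult[OF f(1) g(1) assms(1)] by (rule hclass_in_carrier[OF fg])
  fix E assume "E \<in> carrier ?\<pi>"
  then obtain h where h: "cube_loop n Z z h" "E = hclass n Z z h" by (rule in_homotopy_groupE)
  note gh = cube_loop_concat_along[OF g(1) h(1) assms(1)]
  show "C \<otimes>\<^bsub>?\<pi>\<^esub> D \<otimes>\<^bsub>?\<pi>\<^esub> E = C \<otimes>\<^bsub>?\<pi>\<^esub> (D \<otimes>\<^bsub>?\<pi>\<^esub> E)"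
    using hclass_eqI[OF cube_homotopic_concat_assoc[OF f(1) g(1) h(1) assms(1)]]
    by (simp only: f(2) g(2) h(2) hclass_mult f(1) g(1) h(1) fg gh assms(1))
qed

theorem comm_group_homotopy_group:
  assumes "2 \<le> n" "z \<in> topspace Z"
  shows "comm_group (homotopy_group n Z z)"
proof -
  have "0 < n" using assms(1) by simp
  then interpret group "homotopy_group n Z z" using assms(2) by (rule group_homotopy_group)
  show ?thesis
  proof (rule group_comm_groupI)
    fix C D assume "C \<in> carrier (homotopy_group n Z z)" and D: "D \<in> carrier (homotopy_group n Z z)"
    then obtain f where f: "cube_loop n Z z f" "C = hclass n Z z f" by (elim in_homotopy_groupE)
    obtain g where g: "cube_loop n Z z g" "D = hclass n Z z g" using D by (rule in_homotopy_groupE)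
    show "C \<otimes>\<^bsub>homotopy_group n Z z\<^esub> D = D \<otimes>\<^bsub>homotopy_group n Z z\<^esub> C"
      unfolding f(2) g(2) hclass_mult[OF f(1) g(1) \<open>0 < n\<close>] hclass_mult[OF g(1) f(1) \<open>0 < n\<close>]
      by (rule hclass_eqI[OF cube_homotopic_concat_commute[OF f(1) g(1) \<open>0 < n\<close> assms(1)]])
  qed
qed

lemma cube_homotopic_postcompose:
  assumes "cube_homotopic n Z z f g" "continuous_map Z W \<phi>" "\<phi> z = w"
  shows "cube_homotopic n W w (\<phi> \<circ> f) (\<phi> \<circ> g)"
  using assms(1,2) by (rule homotopic_with_compose_continuous_map_left) (use assms(3) in auto)

lemma cube_loop_postcompose:
  "\<lbrakk>cube_loop n Z z f; continuous_map Z W \<phi>; \<phi> z = w\<rbrakk> \<Longrightarrow> cube_loop n W w (\<phi> \<circ> f)"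
  using cube_homotopic_postcompose[where f = f and g = f] by (simp only: homotopic_with_refl)

lemma induced_hom_hclass:
  assumes "cube_loop n Z z f" "continuous_map Z W \<phi>" "\<phi> z = w"
  shows "induced_hom n W w \<phi> (hclass n Z z f) = hclass n W w (\<phi> \<circ> f)"
  unfolding induced_hom_def
  by (rule hclass_eqI[symmetric])
    (rule cube_homotopic_postcompose[OF hclass_representative_homotopic[OF assms(1)] assms(2,3)])

lemma induced_hom_in_hom:
  assumes "continuous_map Z W \<phi>" "\<phi> z = w" "0 < n"
  shows "induced_hom n W w \<phi> \<in> hom (homotopy_group n Z z) (homotopy_group n W w)"
proof (rule homI)
  note hclass = induced_hom_hclass[OF _ assms(1,2)] and loop = cube_loop_postcompose[OF _ assms(1,2)]
  fix C assume "C \<in> carrier (homotopy_group n Z z)"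
  then obtain f where f: "cube_loop n Z z f" "C = hclass n Z z f" by (rule in_homotopy_groupE)
  then show "induced_hom n W w \<phi> C \<in> carrier (homotopy_group n W w)"
    using hclass_in_carrier[OF loop[OF f(1)]] by (simp add: hclass)
  fix D assume "D \<in> carrier (homotopy_group n Z z)"
  then obtain g where g: "cube_loop n Z z g" "D = hclass n Z z g" by (rule in_homotopy_groupE)
  have "\<phi> \<circ> cube_concat_along 0 f g = cube_concat_along 0 (\<phi> \<circ> f) (\<phi> \<circ> g)"
    by (auto simp: cube_concat_along_def)
  then show "induced_hom n W w \<phi> (C \<otimes>\<^bsub>homotopy_group n Z z\<^esub> D) =
        induced_hom n W w \<phi> C \<otimes>\<^bsub>homotopy_group n W w\<^esub> induced_hom n W w \<phi> D"
    using hclass[OF cube_loop_concat_along[OF f(1) g(1) \<open>0 < n\<close>]]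
    by (simp only: f(2) g(2) hclass_mult hclass f(1) g(1) loop \<open>0 < n\<close>)
qed

lemma induced_hom_compose:
  assumes "C \<in> carrier (homotopy_group n Z z)" "continuous_map Z W \<phi>" "\<phi> z = w"
    and "continuous_map W V \<psi>" "\<psi> w = v"
  shows "induced_hom n V v \<psi> (induced_hom n W w \<phi> C) = induced_hom n V v (\<psi> \<circ> \<phi>) C"
proof -
  obtain f where f: "cube_loop n Z z f" "C = hclass n Z z f" using assms(1) by (rule in_homotopy_groupE)
  have "continuous_map Z V (\<psi> \<circ> \<phi>)" "(\<psi> \<circ> \<phi>) z = v"
    using assms by (simp_all add: continuous_map_compose)
  then show ?thesis
    unfolding f(2) induced_hom_hclass[OF f(1) assms(2,3)]
    by (simp only: induced_hom_hclass[OF cube_loop_postcompose[OF f(1) assms(2,3)] assms(4,5)]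
        induced_hom_hclass[OF f(1)] o_assoc)
qed

lemma induced_hom_id: "C \<in> carrier (homotopy_group n Z z) \<Longrightarrow> induced_hom n Z z id C = C"
  by (simp add: induced_hom_def homotopy_group_representative)

lemma induced_hom_const: "induced_hom n W w (\<lambda>x. w) C = \<one>\<^bsub>homotopy_group n W w\<^esub>"
  by (simp add: induced_hom_def one_homotopy_group o_def)

section \<open>Maps into the adjunction space\<close>

lemma istopology_disj_sum_top:
  "istopology (\<lambda>U. U \<subseteq> Inl ` topspace X \<union> (\<Union>j<k. (\<lambda>b. Inr (j, b)) ` topspace (A j))
      \<and> openin X {x. Inl x \<in> U} \<and> (\<forall>j<k. openin (A j) {b. Inr (j, b) \<in> U}))"
  unfolding istopology_def vimage_def[symmetric] vimage_Int vimage_Union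
  by (intro conjI allI impI openin_Int openin_Union; blast)

lemma openin_disj_sum_top:
  "openin (disj_sum_top X A k) U \<longleftrightarrow> U \<subseteq> Inl ` topspace X \<union> (\<Union>j<k. (\<lambda>b. Inr (j, b)) ` topspace (A j))
      \<and> openin X {x. Inl x \<in> U} \<and> (\<forall>j<k. openin (A j) {b. Inr (j, b) \<in> U})"
  unfolding disj_sum_top_def topology_inverse'[OF istopology_disj_sum_top] ..

lemma topspace_disj_sum_top:
  "topspace (disj_sum_top X A k) = Inl ` topspace X \<union> (\<Union>j<k. (\<lambda>b. Inr (j, b)) ` topspace (A j))"
    (is "_ = ?S")
proof -
  have "{x. Inl x \<in> ?S} = topspace X" "\<And>j. j < k \<Longrightarrow> {b. Inr (j, b) \<in> ?S} = topspace (A j)" by auto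
  then have "openin (disj_sum_top X A k) ?S" by (simp add: openin_disj_sum_top)
  moreover have "topspace (disj_sum_top X A k) \<subseteq> ?S"
    by (rule conjunct1[OF iffD1[OF openin_disj_sum_top openin_topspace]])
  ultimately show ?thesis using openin_subset by blast
qed

lemma continuous_map_Inl_disj_sum_top: "continuous_map X (disj_sum_top X A k) Inl"
proof -
  have "{p \<in> topspace X. Inl p \<in> U} = {p. Inl p \<in> U}" if "openin (disj_sum_top X A k) U" for U
    using openin_subset[OF that] by (auto simp: topspace_disj_sum_top)
  then show ?thesis by (auto simp: continuous_map_def topspace_disj_sum_top openin_disj_sum_top)
qed

lemma continuous_map_Inr_disj_sum_top:
  assumes "j < k"
  shows "continuous_map (A j) (disj_sum_top X A k) (\<lambda>b. Inr (j, b))"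
proof -
  have "{b \<in> topspace (A j). Inr (j, b) \<in> U} = {b. Inr (j, b) \<in> U}" if "openin (disj_sum_top X A k) U" for U
    using openin_subset[OF that] by (auto simp: topspace_disj_sum_top)
  then show ?thesis using assms by (auto simp: continuous_map_def topspace_disj_sum_top openin_disj_sum_top)
qed

lemma continuous_map_from_disj_sum_top:
  assumes "continuous_map X W (\<lambda>p. f (Inl p))" "\<And>j. j < k \<Longrightarrow> continuous_map (A j) W (\<lambda>b. f (Inr (j, b)))"
  shows "continuous_map (disj_sum_top X A k) W f"
  unfolding continuous_map_def
proof (intro conjI allI impI)
  show "f \<in> topspace (disj_sum_top X A k) \<rightarrow> topspace W"
    using assms by (auto simp: topspace_disj_sum_top continuous_map_def Pi_iff)
  fix U assume U: "openin W U"
  let ?V = "{p \<in> topspace (disj_sum_top X A k). f p \<in> U}"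
  have "{p. Inl p \<in> ?V} = {p \<in> topspace X. f (Inl p) \<in> U}"
    by (auto simp: topspace_disj_sum_top)
  then have "openin X {p. Inl p \<in> ?V}"
    using openin_continuous_map_preimage[OF assms(1) U] by (simp only:)
  moreover have "openin (A j) {b. Inr (j, b) \<in> ?V}" if "j < k" for j
  proof -
    have "{b. Inr (j, b) \<in> ?V} = {b \<in> topspace (A j). f (Inr (j, b)) \<in> U}"
      using that by (auto simp: topspace_disj_sum_top)
    then show ?thesis using openin_continuous_map_preimage[OF assms(2)[OF that] U] by (simp only:)
  qed
  moreover have "?V \<subseteq> topspace (disj_sum_top X A k)" by (rule Collect_restrict)
  ultimately show "openin (disj_sum_top X A k) ?V"
    unfolding openin_disj_sum_top topspace_disj_sum_top[symmetric] by blast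
qed

lemma istopology_quotient_top:
  "istopology (\<lambda>U. U \<subseteq> q ` topspace T \<and> openin T {x \<in> topspace T. q x \<in> U})"
proof -
  have "{x \<in> topspace T. q x \<in> U \<inter> V} = {x \<in> topspace T. q x \<in> U} \<inter> {x \<in> topspace T. q x \<in> V}" for U V
    by auto
  moreover have "{x \<in> topspace T. q x \<in> \<Union>\<K>} = (\<Union>U\<in>\<K>. {x \<in> topspace T. q x \<in> U})" for \<K> by auto
  ultimately show ?thesis unfolding istopology_def by (simp only:) blast
qed

lemma openin_quotient_top:
  "openin (quotient_top T q) U \<longleftrightarrow> U \<subseteq> q ` topspace T \<and> openin T {x \<in> topspace T. q x \<in> U}"
  unfolding quotient_top_def topology_inverse'[OF istopology_quotient_top] ..

lemma quotient_map_quotient_top: "quotient_map T (quotient_top T q) q"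
proof -
  have "{x \<in> topspace T. q x \<in> q ` topspace T} = topspace T" by auto
  then have "openin (quotient_top T q) (q ` topspace T)" by (simp add: openin_quotient_top)
  moreover have "topspace (quotient_top T q) \<subseteq> q ` topspace T"
    by (rule conjunct1[OF iffD1[OF openin_quotient_top openin_topspace]])
  ultimately have "topspace (quotient_top T q) = q ` topspace T" using openin_subset by blast
  then show ?thesis by (auto simp: quotient_map_def openin_quotient_top)
qed

lemma continuous_map_Inl_adj_stage: "continuous_map X (adj_stage X x A a k) Inl"
  using continuous_map_compose[OF continuous_map_Inl_disj_sum_top
      quotient_imp_continuous_map[OF quotient_map_quotient_top[of _ "adj_quot x a"]]]
  by (simp add: adj_stage_def o_def adj_quot_def)

lemma continuous_map_Inr_adj_stage:
  "j < k \<Longrightarrow> continuous_map (A j) (adj_stage X x A a k) (\<lambda>b. adj_quot x a (Inr (j, b)))"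
  using continuous_map_compose[OF continuous_map_Inr_disj_sum_top
      quotient_imp_continuous_map[OF quotient_map_quotient_top[of _ "adj_quot x a"]]]
  by (simp add: adj_stage_def o_def)

lemma continuous_map_from_adj_stage:
  assumes "continuous_map X W (\<lambda>p. f (Inl p))"
    and "\<And>j. j < k \<Longrightarrow> continuous_map (A j) W (\<lambda>b. f (adj_quot x a (Inr (j, b))))"
  shows "continuous_map (adj_stage X x A a k) W f"
proof -
  have "continuous_map (disj_sum_top X A k) W (f \<circ> adj_quot x a)"
    using assms by (intro continuous_map_from_disj_sum_top) (simp_all add: adj_quot_def)
  then show ?thesis
    unfolding adj_stage_def by (rule continuous_compose_quotient_map[OF quotient_map_quotient_top])
qed

lemma continuous_map_Adj_coord: "continuous_map (Adj X x A a) (adj_stage X x A a k) (\<lambda>y. y k)"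
  unfolding Adj_def by (rule continuous_map_from_subtopology) (rule continuous_map_product_projection, simp)

lemma continuous_map_adj_r: "continuous_map (Adj X x A a) X adj_r"
proof -
  have "continuous_map (adj_stage X x A a 0) X projl"
    by (rule continuous_map_from_adj_stage) (auto simp: continuous_map_id[unfolded id_def])
  from continuous_map_compose[OF continuous_map_Adj_coord this] show ?thesis
    by (simp add: adj_r_def[abs_def] o_def)
qed

lemma continuous_map_adj_rj:
  assumes "a j \<in> topspace (A j)"
  shows "continuous_map (Adj X x A a) (A j) (adj_rj a j)"
proof -
  let ?f = "\<lambda>p. case p of Inl _ \<Rightarrow> a j | Inr (i, b) \<Rightarrow> if i = j then b else a j"
  have "continuous_map (adj_stage X x A a (Suc j)) (A j) ?f"
  proof (rule continuous_map_from_adj_stage)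
    fix i
    have "(\<lambda>b. ?f (adj_quot x a (Inr (i, b)))) = (if i = j then id else (\<lambda>b. a j))"
      by (auto simp: adj_quot_def fun_eq_iff)
    then show "continuous_map (A i) (A j) (\<lambda>b. ?f (adj_quot x a (Inr (i, b))))"
      using assms by simp
  qed (use assms in simp)
  from continuous_map_compose[OF continuous_map_Adj_coord this] show ?thesis
    by (simp add: adj_rj_def[abs_def] o_def)
qed

text \<open>The point of the inverse limit with retractions \<open>p\<close> in \<open>X\<close> and \<open>b j\<close> in \<open>A j\<close>; it is
  meaningful only when at most one \<open>b j\<close> differs from \<open>a j\<close>, and then \<open>p = x j\<close>.\<close>

definition adj_point :: "(nat \<Rightarrow> 'b) \<Rightarrow> 'a \<Rightarrow> (nat \<Rightarrow> 'b) \<Rightarrow> nat \<Rightarrow> 'a + nat \<times> 'b" where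
  "adj_point a p b k = (if \<exists>j<k. b j \<noteq> a j then let j = (LEAST j. b j \<noteq> a j) in Inr (j, b j) else Inl p)"

definition adj_compatible :: "(nat \<Rightarrow> 'a) \<Rightarrow> (nat \<Rightarrow> 'b) \<Rightarrow> 'a \<Rightarrow> (nat \<Rightarrow> 'b) \<Rightarrow> bool" where
  "adj_compatible x a p b \<longleftrightarrow> (\<forall>j. b j \<noteq> a j \<longrightarrow> p = x j \<and> (\<forall>i. b i \<noteq> a i \<longrightarrow> i = j))"

lemma adj_point_attached:
  assumes "adj_compatible x a p b" "b j \<noteq> a j"
  shows "adj_point a p b k = (if j < k then Inr (j, b j) else Inl p)"
proof -
  have unique: "i = j" if "b i \<noteq> a i" for i using assms that by (auto simp: adj_compatible_def)
  have "(LEAST j. b j \<noteq> a j) = j"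
    by (rule Least_equality) (use assms(2) in \<open>auto dest: unique\<close>)
  moreover have "(\<exists>i<k. b i \<noteq> a i) \<longleftrightarrow> j < k" using unique assms(2) by blast
  ultimately show ?thesis by (simp add: adj_point_def)
qed

lemma adj_point_unattached: "(\<And>j. j < k \<Longrightarrow> b j = a j) \<Longrightarrow> adj_point a p b k = Inl p"
  unfolding adj_point_def by (rule if_not_P) blast

lemma adj_point_cases:
  assumes "adj_compatible x a p b"
  obtains (base) "\<And>j. j < k \<Longrightarrow> b j = a j" "adj_point a p b k = Inl p"
  | (attached) j where "j < k" "b j \<noteq> a j" "p = x j" "\<And>i. i \<noteq> j \<Longrightarrow> b i = a i" "adj_point a p b k = Inr (j, b j)"
proof (cases "\<exists>j<k. b j \<noteq> a j")
  case True
  then obtain j where j: "j < k" "b j \<noteq> a j" by blast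
  then have "p = x j" "\<And>i. i \<noteq> j \<Longrightarrow> b i = a i" using assms by (auto simp: adj_compatible_def)
  then show thesis using attached j adj_point_attached[OF assms j(2), of k] by simp
next
  case False
  then show thesis by (intro base adj_point_unattached) blast+
qed

lemma adj_r_point: "adj_r (adj_point a p b) = p"
  by (simp add: adj_r_def adj_point_def)

lemma adj_rj_point:
  assumes "adj_compatible x a p b"
  shows "adj_rj a j (adj_point a p b) = b j"
  using assms by (cases rule: adj_point_cases[where k = "Suc j"]) (auto simp: adj_rj_def)

lemma adj_point_base: "adj_point a p a = adj_incl p"
  by (simp add: adj_point_def adj_incl_def fun_eq_iff)

lemma adj_compatible_base: "adj_compatible x a p a"
  by (simp add: adj_compatible_def)

lemma adj_r_incl: "adj_r (adj_incl p) = p"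
  by (simp add: adj_r_def adj_incl_def)

lemma adj_rj_incl: "adj_rj a j (adj_incl p) = a j"
  by (simp add: adj_rj_def adj_incl_def)

lemma adj_r_comp_incl: "adj_r \<circ> adj_incl = id"
  by (simp add: fun_eq_iff adj_r_incl)

lemma adj_rj_comp_incl: "adj_rj a j \<circ> adj_incl = (\<lambda>p. a j)"
  by (simp add: fun_eq_iff adj_rj_incl)

lemma adj_point_bond:
  assumes "adj_compatible x a p b"
  shows "adj_bond x k (adj_point a p b (Suc k)) = adj_point a p b k"
  using assms
proof (cases rule: adj_point_cases[where k = "Suc k"])
  case base
  then show ?thesis by (simp add: adj_bond_def adj_point_unattached)
next
  case (attached j)
  show ?thesis
    using adj_point_attached[OF assms attached(2), of k] attached(1,3,5)
    by (cases "j = k") (simp_all add: adj_bond_def)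
qed

lemma adj_point_in_stage:
  assumes "adj_compatible x a p b" "p \<in> topspace X" "\<And>j. b j \<in> topspace (A j)"
  shows "adj_point a p b k \<in> topspace (adj_stage X x A a k)"
  using assms(1)
proof (cases rule: adj_point_cases[where k = k])
  case base
  then show ?thesis
    using funcset_mem[OF continuous_map_funspace[OF continuous_map_Inl_adj_stage] assms(2)] by simp
next
  case (attached j)
  then have "adj_point a p b k = adj_quot x a (Inr (j, b j))" by (simp add: adj_quot_def)
  then show ?thesis
    using funcset_mem[OF continuous_map_funspace[OF continuous_map_Inr_adj_stage[OF attached(1)]] assms(3)]
    by simp
qed

text \<open>The right-hand side only involves the retractions separately: this is why the topology of a
  finite stage is induced by its retractions.\<close>

lemma adj_point_in_iff:
  assumes "adj_compatible x a p b"
  shows "adj_point a p b k \<in> W \<longleftrightarrow>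
    Inl p \<in> W \<and> (\<forall>j<k. Inl (x j) \<in> W \<longrightarrow> adj_quot x a (Inr (j, b j)) \<in> W)
    \<or> (\<exists>j<k. Inl (x j) \<notin> W \<and> adj_quot x a (Inr (j, b j)) \<in> W)"
  using assms
proof (cases rule: adj_point_cases[where k = k])
  case base
  then show ?thesis by (auto simp: adj_quot_def)
next
  case (attached j)
  have "adj_quot x a (Inr (i, b i)) = Inl (x i)" if "i \<noteq> j" for i
    using attached(4)[OF that] by (simp add: adj_quot_def)
  moreover have "adj_quot x a (Inr (j, b j)) = Inr (j, b j)" using attached(2) by (simp add: adj_quot_def)
  ultimately show ?thesis using attached(1,3,5) by metis
qed

lemma continuous_map_into_adj_stage:
  assumes H: "continuous_map T X H" and G: "\<And>j. continuous_map T (A j) (\<lambda>t. G t j)"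
    and compatible: "\<And>t. t \<in> topspace T \<Longrightarrow> adj_compatible x a (H t) (G t)"
  shows "continuous_map T (adj_stage X x A a k) (\<lambda>t. adj_point a (H t) (G t) k)"
  unfolding continuous_map_def
proof (intro conjI allI impI)
  show "(\<lambda>t. adj_point a (H t) (G t) k) \<in> topspace T \<rightarrow> topspace (adj_stage X x A a k)"
    using continuous_map_funspace[OF H] continuous_map_funspace[OF G]
    by (auto intro!: adj_point_in_stage compatible)
  fix W assume W: "openin (adj_stage X x A a k) W"
  let ?base = "{t \<in> topspace T. Inl (H t) \<in> W}"
  let ?piece = "\<lambda>j. {t \<in> topspace T. adj_quot x a (Inr (j, G t j)) \<in> W}"
  let ?met = "{j. j < k \<and> Inl (x j) \<in> W}" and ?missed = "{j. j < k \<and> Inl (x j) \<notin> W}"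
  have "openin T ?base"
    using openin_continuous_map_preimage[OF continuous_map_compose[OF H continuous_map_Inl_adj_stage] W]
    by (simp add: o_def)
  moreover have piece: "openin T (?piece j)" if "j < k" for j
    using openin_continuous_map_preimage[OF continuous_map_compose[OF G continuous_map_Inr_adj_stage[OF that]] W]
    by (simp add: o_def)
  ultimately have "openin T (?base \<inter> ((\<Inter>j\<in>?met. ?piece j) \<inter> topspace T) \<union> (\<Union>j\<in>?missed. ?piece j))"
    by (intro openin_Un openin_Int openin_INT openin_Union) auto
  moreover have "{t \<in> topspace T. adj_point a (H t) (G t) k \<in> W} =
      ?base \<inter> ((\<Inter>j\<in>?met. ?piece j) \<inter> topspace T) \<union> (\<Union>j\<in>?missed. ?piece j)"
    using adj_point_in_iff[OF compatible] by auto
  ultimately show "openin T {t \<in> topspace T. adj_point a (H t) (G t) k \<in> W}" by simp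
qed

proposition continuous_map_into_Adj:
  assumes "continuous_map T X H" "\<And>j. continuous_map T (A j) (\<lambda>t. G t j)"
    and compatible: "\<And>t. t \<in> topspace T \<Longrightarrow> adj_compatible x a (H t) (G t)"
  shows "continuous_map T (Adj X x A a) (\<lambda>t. adj_point a (H t) (G t))"
proof -
  have into_product: "continuous_map T (product_topology (adj_stage X x A a) UNIV) (\<lambda>t. adj_point a (H t) (G t))"
    using continuous_map_into_adj_stage[OF assms] by (simp add: continuous_map_componentwise_UNIV)
  moreover have "adj_point a (H t) (G t) \<in> topspace (product_topology (adj_stage X x A a) UNIV)"
    if "t \<in> topspace T" for t
    using continuous_map_funspace[OF into_product] that by blast
  ultimately show ?thesis
    unfolding Adj_def using adj_point_bond[OF compatible] by (auto intro!: continuous_map_into_subtopology)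
qed

lemma continuous_map_adj_incl:
  assumes "\<And>j. a j \<in> topspace (A j)"
  shows "continuous_map X (Adj X x A a) adj_incl"
  using continuous_map_into_Adj[of X X "\<lambda>p. p" A "\<lambda>p. a" x a] assms
  by (simp add: adj_compatible_base adj_point_base continuous_map_id[unfolded id_def])

section \<open>The splitting\<close>

definition unit_clamp :: "real \<Rightarrow> real" where
  "unit_clamp u = max 0 (min 1 u)"

definition plateau :: "real \<Rightarrow> real" where
  "plateau u = unit_clamp (8 * min u (1 - u))"

definition stretch :: "real \<Rightarrow> real" where
  "stretch u = unit_clamp (2 * u - 1/2)"

lemma unit_clamp_bounds: "0 \<le> unit_clamp u" "unit_clamp u \<le> 1"
  by (simp_all add: unit_clamp_def)

lemma unit_clamp_eq: "u \<le> 0 \<Longrightarrow> unit_clamp u = 0" "1 \<le> u \<Longrightarrow> unit_clamp u = 1"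
  by (simp_all add: unit_clamp_def)

lemma unit_clamp_interior: "\<lbrakk>0 < unit_clamp u; unit_clamp u < 1\<rbrakk> \<Longrightarrow> 0 < u \<and> u < 1"
  by (auto simp: unit_clamp_def max_def min_def split: if_splits)

lemma continuous_on_unit_clamp [continuous_intros]:
  "continuous_on S f \<Longrightarrow> continuous_on S (\<lambda>t. unit_clamp (f t))"
  unfolding unit_clamp_def by (intro continuous_intros)

lemma plateau_eq: "\<lbrakk>1/8 \<le> u; u \<le> 7/8\<rbrakk> \<Longrightarrow> plateau u = 1" "u \<le> 0 \<or> 1 \<le> u \<Longrightarrow> plateau u = 0"
  by (auto simp: plateau_def min_def intro!: unit_clamp_eq)

lemma stretch_eq: "u \<le> 1/4 \<Longrightarrow> stretch u = 0" "3/4 \<le> u \<Longrightarrow> stretch u = 1"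
  by (auto simp: stretch_def intro!: unit_clamp_eq)

lemma stretch_bounds: "0 \<le> stretch u" "stretch u \<le> 1"
  by (simp_all add: stretch_def unit_clamp_bounds)

lemma stretch_interior: "\<lbrakk>0 < stretch u; stretch u < 1\<rbrakk> \<Longrightarrow> 1/4 < u \<and> u < 3/4"
  using unit_clamp_interior[of "2 * u - 1/2"] by (auto simp: stretch_def)

lemma plateau_over_stretch: "stretch u \<notin> {0, 1} \<Longrightarrow> plateau u = 1"
  using stretch_bounds[of u] stretch_interior[of u] by (intro plateau_eq) auto

lemma continuous_on_plateau [continuous_intros]:
  "continuous_on S f \<Longrightarrow> continuous_on S (\<lambda>t. plateau (f t))"
  unfolding plateau_def by (intro continuous_intros)

lemma continuous_on_stretch [continuous_intros]:
  "continuous_on S f \<Longrightarrow> continuous_on S (\<lambda>t. stretch (f t))"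
  unfolding stretch_def by (intro continuous_intros)

lemma plateau_bounds: "0 \<le> plateau u" "plateau u \<le> 1"
  by (simp_all add: plateau_def unit_clamp_bounds)

lemma interval_reparam_plateau: "interval_reparam plateau"
  by (rule interval_reparamI) (auto simp: plateau_bounds plateau_eq intro!: continuous_intros)

lemma interval_reparam_stretch: "interval_reparam stretch"
  by (rule interval_reparamI) (auto simp: stretch_bounds stretch_eq intro!: continuous_intros)

definition twin_plateau :: "real \<Rightarrow> real" where
  "twin_plateau u = plateau (2 * u) + plateau (2 * u - 1)"

definition twin_stretch :: "real \<Rightarrow> real" where
  "twin_stretch u = (stretch (2 * u) + stretch (2 * u - 1)) / 2"

lemma twin_plateau_eq:
  "u \<le> 1/2 \<Longrightarrow> twin_plateau u = plateau (2 * u)" "1/2 \<le> u \<Longrightarrow> twin_plateau u = plateau (2 * u - 1)"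
  by (auto simp: twin_plateau_def plateau_eq)

lemma twin_stretch_eq:
  "u \<le> 1/2 \<Longrightarrow> twin_stretch u = stretch (2 * u) / 2"
  "1/2 \<le> u \<Longrightarrow> twin_stretch u = (1 + stretch (2 * u - 1)) / 2"
  by (auto simp: twin_stretch_def stretch_eq)

lemma interval_reparam_twin_plateau: "interval_reparam twin_plateau"
proof (rule interval_reparamI)
  show "0 \<le> twin_plateau u \<and> twin_plateau u \<le> 1" for u
    by (cases "u \<le> 1/2") (simp_all add: twin_plateau_eq plateau_bounds)
qed (auto simp: twin_plateau_def[abs_def] plateau_eq intro!: continuous_intros)

lemma interval_reparam_twin_stretch: "interval_reparam twin_stretch"
proof (rule interval_reparamI)
  show "0 \<le> twin_stretch u \<and> twin_stretch u \<le> 1" for u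
    using stretch_bounds[of "2 * u"] stretch_bounds[of "2 * u - 1"] by (simp add: twin_stretch_def)
qed (auto simp: twin_stretch_def[abs_def] stretch_eq intro!: continuous_intros)

lemma twin_stretch_interior:
  assumes "twin_stretch u \<notin> {0, 1/2, 1}"
  shows "twin_plateau u = 1" "plateau u = 1"
proof -
  have "1/4 < 2 * u \<and> 2 * u < 3/4 \<or> 1/4 < 2 * u - 1 \<and> 2 * u - 1 < 3/4"
  proof (cases "u \<le> 1/2")
    case True
    then show ?thesis
      using assms stretch_bounds[of "2 * u"] stretch_interior[of "2 * u"] by (auto simp: twin_stretch_eq)
  next
    case False
    then show ?thesis
      using assms stretch_bounds[of "2 * u - 1"] stretch_interior[of "2 * u - 1"]
      by (auto simp: twin_stretch_eq)
  qed
  then show "twin_plateau u = 1" "plateau u = 1"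
    by (auto simp: twin_plateau_def plateau_eq)
qed

lemma plateau_over_interpolation:
  assumes "interpolate twin_stretch stretch s u \<notin> {0, 1}"
  shows "plateau u = 1"
proof (rule plateau_eq)
  show "1/8 \<le> u"
  proof (rule ccontr)
    assume "\<not> 1/8 \<le> u"
    then have "twin_stretch u = 0" "stretch u = 0" by (simp_all add: twin_stretch_eq stretch_eq)
    then show False using assms by (simp add: interpolate_agree)
  qed
  show "u \<le> 7/8"
  proof (rule ccontr)
    assume "\<not> u \<le> 7/8"
    then have "twin_stretch u = 1" "stretch u = 1" by (simp_all add: twin_stretch_eq stretch_eq)
    then show False using assms by (simp add: interpolate_agree)
  qed
qed

locale adj_resting_path =
  fixes X :: "'a topology" and x :: "nat \<Rightarrow> 'a" and A :: "nat \<Rightarrow> 'b topology" and a :: "nat \<Rightarrow> 'b"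
    and n :: nat and \<beta> :: "real \<Rightarrow> 'a" and l r :: "nat \<Rightarrow> real"
  assumes a_in: "a j \<in> topspace (A j)"
    and n_ge_2: "2 \<le> n"
    and path: "continuous_map (top_of_set {0..1}) X \<beta>"
    and rest_bounds: "0 \<le> l j \<and> l j < r j \<and> r j \<le> 1"
    and path_rest: "t \<in> {l j..r j} \<Longrightarrow> \<beta> t = x j"
    and rests_disjoint: "i \<noteq> j \<Longrightarrow> r i < l j \<or> r j < l i"
begin

lemma n_gt_0: "0 < n"
  using n_ge_2 by simp

lemma n_gt_1: "1 < n"
  using n_ge_2 by simp

abbreviation Y :: "(nat \<Rightarrow> 'a + nat \<times> 'b) topology" where
  "Y \<equiv> Adj X x A a"

lemma continuous_map_retraction: "continuous_map Y (A j) (adj_rj a j)"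
  by (rule continuous_map_adj_rj[OF a_in])

lemma continuous_map_inclusion: "continuous_map X Y adj_incl"
  by (rule continuous_map_adj_incl[OF a_in])

definition rim :: "(nat \<Rightarrow> real) \<Rightarrow> real" where
  "rim t = (\<Prod>i\<in>{1..<n}. plateau (t i))"

definition base_map :: "real \<Rightarrow> (nat \<Rightarrow> real) \<Rightarrow> 'a" where
  "base_map c t = \<beta> (c * rim t * stretch (t 1))"

definition box_coord :: "nat \<Rightarrow> nat \<Rightarrow> real \<Rightarrow> real" where
  "box_coord j i u = (if i = 1 then unit_clamp ((2 * u - 1/2 - l j) / (r j - l j)) else stretch u)"

definition box_point :: "nat \<Rightarrow> real \<Rightarrow> (nat \<Rightarrow> real) \<Rightarrow> nat \<Rightarrow> real" where
  "box_point j v t = (\<lambda>i\<in>{..<n}. if i = 0 then v else box_coord j i (t i))"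

text \<open>The profiles are functions of \<open>t 0\<close>: \<open>\<kappa>\<close> says how far the walk along \<open>\<beta>\<close> is extended, and \<open>v\<close> is
  coordinate \<open>0\<close> inside every box.\<close>

definition assemble ::
    "(real \<Rightarrow> real) \<Rightarrow> (real \<Rightarrow> real) \<Rightarrow> (nat \<Rightarrow> (nat \<Rightarrow> real) \<Rightarrow> 'b) \<Rightarrow> (nat \<Rightarrow> real) \<Rightarrow> nat \<Rightarrow> 'a + nat \<times> 'b" where
  "assemble \<kappa> v g t = adj_point a (base_map (\<kappa> (t 0)) t) (\<lambda>j. g j (box_point j (v (t 0)) t))"

abbreviation adj_cube_homotopic ::
    "((nat \<Rightarrow> real) \<Rightarrow> nat \<Rightarrow> 'a + nat \<times> 'b) \<Rightarrow> ((nat \<Rightarrow> real) \<Rightarrow> nat \<Rightarrow> 'a + nat \<times> 'b) \<Rightarrow> bool" where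
  "adj_cube_homotopic \<equiv> cube_homotopic n Y (adj_incl (\<beta> 0))"

lemma rim_bounds: "0 \<le> rim t" "rim t \<le> 1"
  unfolding rim_def by (auto intro!: prod_nonneg prod_le_1 simp: plateau_bounds)

lemma box_coord_ends: "box_coord j i 0 = 0" "box_coord j i 1 = 1"
  using rest_bounds[of j] by (auto simp: box_coord_def stretch_eq divide_nonpos_pos intro!: unit_clamp_eq)

lemma interval_reparam_box_coord: "interval_reparam (box_coord j i)"
proof (rule interval_reparamI)
  have "r j - l j \<noteq> 0" using rest_bounds[of j] by simp
  then show "continuous_on {0..1} (box_coord j i)"
    unfolding box_coord_def by (cases "i = 1") (auto intro!: continuous_intros)
qed (simp_all add: box_coord_ends, simp add: box_coord_def unit_clamp_bounds stretch_bounds)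

lemma box_point_0: "box_point j v t 0 = v"
  using n_gt_0 by (simp add: box_point_def)

lemma box_point_upd:
  "box_point j v (t(0 := u)) = box_point j v t"
  "(box_point j v t)(0 := u) = box_point j u t"
  using n_gt_0 by (auto simp: box_point_def fun_eq_iff)

lemma base_map_upd: "base_map c (t(0 := u)) = base_map c t"
  by (simp add: base_map_def rim_def)

lemma box_point_in_cube: "v \<in> {0..1} \<Longrightarrow> box_point j v t \<in> topspace (cube n)"
  by (rule in_cubeI) (auto simp: box_point_def box_coord_def unit_clamp_bounds stretch_bounds)

lemma box_point_in_bdry:
  assumes "t \<in> cube_bdry n" "v \<in> {0..1}" "t 0 = 0 \<or> t 0 = 1 \<Longrightarrow> v = 0 \<or> v = 1"
  shows "box_point j v t \<in> cube_bdry n"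
proof -
  obtain i where i: "i < n" "t i = 0 \<or> t i = 1" using assms(1) by (rule in_cube_bdryE)
  then show ?thesis
    using assms(3) box_coord_ends
    by (intro in_cube_bdryI[OF box_point_in_cube[OF assms(2)], of i]) (auto simp: box_point_def)
qed

lemma base_map_bdry:
  assumes "t \<in> cube_bdry n" "t 0 = 0 \<or> t 0 = 1 \<Longrightarrow> c = 0"
  shows "base_map c t = \<beta> 0"
proof -
  obtain i where i: "i < n" "t i = 0 \<or> t i = 1" using assms(1) by (rule in_cube_bdryE)
  have "c * rim t = 0"
  proof (cases "i = 0")
    case False
    then have "rim t = 0"
      unfolding rim_def using i by (intro prod_zero) (auto intro!: bexI[of _ i] simp: plateau_eq)
    then show ?thesis by simp
  qed (use i assms(2) in auto)
  then show ?thesis by (simp only: base_map_def mult_zero_left)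
qed

lemma box_point_interior:
  assumes "v \<in> {0..1}" "box_point j v t \<notin> cube_bdry n"
  shows "2 * t 1 - 1/2 \<in> {l j<..<r j}" "base_map 1 t = x j"
proof -
  have interior: "0 < box_point j v t i \<and> box_point j v t i < 1" if "i < n" for i
    using in_cube_bdryI[OF box_point_in_cube[OF assms(1)] that] assms(2)
      cube_coord_bounds[OF box_point_in_cube[OF assms(1)] that]
    by (metis order_le_less)
  have "0 < (2 * t 1 - 1/2 - l j) / (r j - l j) \<and> (2 * t 1 - 1/2 - l j) / (r j - l j) < 1"
    using interior[of 1] n_gt_1 unit_clamp_interior by (auto simp: box_point_def box_coord_def)
  then show t1: "2 * t 1 - 1/2 \<in> {l j<..<r j}" using rest_bounds[of j] by (auto simp: field_simps)
  have "plateau (t i) = 1" if "i \<in> {1..<n}" for i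
  proof (cases "i = 1")
    case True
    then show ?thesis using t1 rest_bounds[of j] by (auto intro!: plateau_eq)
  next
    case False
    then have "1/4 < t i \<and> t i < 3/4"
      using that interior[of i] stretch_interior by (auto simp: box_point_def box_coord_def)
    then show ?thesis by (auto intro!: plateau_eq)
  qed
  then have "rim t = 1" by (simp add: rim_def)
  moreover have "stretch (t 1) = 2 * t 1 - 1/2"
    using t1 rest_bounds[of j] by (simp add: stretch_def unit_clamp_def)
  ultimately show "base_map 1 t = x j" using path_rest[of "2 * t 1 - 1/2" j] t1 by (simp add: base_map_def)
qed

lemma adj_compatible_boxes:
  assumes "v \<in> {0..1}" and g: "\<And>j t. t \<in> cube_bdry n \<Longrightarrow> g j t = a j"
    and full: "\<And>j. g j (box_point j v t) \<noteq> a j \<Longrightarrow> c = 1"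
  shows "adj_compatible x a (base_map c t) (\<lambda>j. g j (box_point j v t))"
proof -
  have interior: "2 * t 1 - 1/2 \<in> {l j<..<r j}" "base_map 1 t = x j" if "g j (box_point j v t) \<noteq> a j" for j
    using box_point_interior[OF assms(1), of j t] g that by blast+
  have "i = j" if "g i (box_point i v t) \<noteq> a i" "g j (box_point j v t) \<noteq> a j" for i j
    using interior(1)[OF that(1)] interior(1)[OF that(2)] rests_disjoint[of i j] by fastforce
  then show ?thesis using interior(2) full unfolding adj_compatible_def by metis
qed

lemma continuous_map_base_map:
  assumes c: "continuous_map T (top_of_set {0..1}) c" and F: "continuous_map T (cube n) F"
  shows "continuous_map T X (\<lambda>p. base_map (c p) (F p))"
proof -
  have coord: "continuous_map T euclideanreal (\<lambda>p. f (F p i))" if "i < n" "continuous_on {0..1} f"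
    for f :: "real \<Rightarrow> real" and i
    using continuous_map_compose[OF continuous_map_cube_coord[OF F that(1)], of euclideanreal f] that(2)
    by (simp add: o_def)
  have "continuous_map T euclideanreal (\<lambda>p. c p * rim (F p) * stretch (F p 1))"
    unfolding rim_def using n_gt_1 continuous_map_into_fulltopology[OF c]
    by (intro continuous_map_real_mult continuous_map_prod coord continuous_intros) auto
  moreover have "c p * rim (F p) * stretch (F p 1) \<in> {0..1}" if "p \<in> topspace T" for p
    using funcset_mem[OF continuous_map_funspace[OF c] that] rim_bounds[of "F p"] stretch_bounds[of "F p 1"]
    by (auto intro!: mult_nonneg_nonneg mult_le_one)
  ultimately have "continuous_map T (top_of_set {0..1}) (\<lambda>p. c p * rim (F p) * stretch (F p 1))"
    by (intro continuous_map_into_subtopology) auto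
  from continuous_map_compose[OF this path] show ?thesis by (simp add: base_map_def o_def)
qed

lemma continuous_map_box_point:
  assumes v: "continuous_map T (top_of_set {0..1}) v" and F: "continuous_map T (cube n) F"
  shows "continuous_map T (cube n) (\<lambda>p. box_point j (v p) (F p))"
proof (rule continuous_map_into_cube)
  fix i assume i: "i < n"
  have "continuous_map T (top_of_set {0..1}) (\<lambda>p. box_coord j i (F p i))"
    using continuous_map_compose[OF continuous_map_cube_coord[OF F i], of "top_of_set {0..1}" "box_coord j i"]
      interval_reparam_box_coord[of j i]
    by (simp add: o_def interval_reparam_def image_subset_iff_funcset)
  then show "continuous_map T (top_of_set {0..1}) (\<lambda>p. box_point j (v p) (F p) i)"
    using i v by (cases "i = 0") (simp_all add: box_point_def)
qed (simp add: box_point_def)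

lemma assemble_homotopic:
  assumes h: "\<And>j. continuous_map (homotopy_cube n) (A j) (h j)"
      "\<And>j s t. \<lbrakk>0 \<le> s; s \<le> 1; t \<in> cube_bdry n\<rbrakk> \<Longrightarrow> h j (s, t) = a j"
    and \<kappa>: "interval_reparam \<kappa>" "\<kappa> 0 = 0" "\<kappa> 1 = 0" "interval_reparam \<kappa>'" "\<kappa>' 0 = 0" "\<kappa>' 1 = 0"
    and v: "interval_reparam v" "interval_reparam v'" "v 0 = v' 0" "v 1 = v' 1"
    and support: "\<And>j s u t. \<lbrakk>0 \<le> s; s \<le> 1; t \<in> topspace (cube n); t 0 = interpolate v v' s u; h j (s, t) \<noteq> a j\<rbrakk>
      \<Longrightarrow> \<kappa> u = 1 \<and> \<kappa>' u = 1"
  shows "adj_cube_homotopic (assemble \<kappa> v (\<lambda>j t. h j (0, t))) (assemble \<kappa>' v' (\<lambda>j t. h j (1, t)))"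
proof (rule cube_homotopicI)
  let ?T = "homotopy_cube n"
  let ?\<kappa> = "\<lambda>p. interpolate \<kappa> \<kappa>' (fst p) (snd p 0)" and ?v = "\<lambda>p. interpolate v v' (fst p) (snd p 0)"
  let ?H = "\<lambda>p. base_map (?\<kappa> p) (snd p)" and ?G = "\<lambda>p j. h j (fst p, box_point j (?v p) (snd p))"
  note coord = continuous_map_homotopy_coord[OF n_gt_0]
  note \<kappa>_cont = continuous_map_interpolate[OF \<kappa>(1,4) continuous_map_homotopy_time coord]
  note v_cont = continuous_map_interpolate[OF v(1,2) continuous_map_homotopy_time coord]
  have v_unit: "?v p \<in> {0..1}" if "p \<in> topspace ?T" for p
    using funcset_mem[OF continuous_map_funspace[OF v_cont] that] by simp
  show "continuous_map ?T Y (\<lambda>p. adj_point a (?H p) (?G p))"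
  proof (rule continuous_map_into_Adj)
    show "continuous_map ?T X ?H"
      by (rule continuous_map_base_map[OF \<kappa>_cont continuous_map_homotopy_point])
    have "continuous_map ?T ?T (\<lambda>p. (fst p, box_point j (?v p) (snd p)))" for j
      by (intro continuous_map_pairedI continuous_map_homotopy_time continuous_map_box_point v_cont
          continuous_map_homotopy_point)
    from continuous_map_compose[OF this h(1)] show "continuous_map ?T (A j) (\<lambda>p. ?G p j)" for j
      by (simp add: o_def)
    fix p assume p: "p \<in> topspace ?T"
    show "adj_compatible x a (?H p) (?G p)"
    proof (rule adj_compatible_boxes[OF v_unit[OF p], where g = "\<lambda>j t. h j (fst p, t)"])
      fix j assume "h j (fst p, box_point j (?v p) (snd p)) \<noteq> a j"
      then show "?\<kappa> p = 1"
        using support[of "fst p" "box_point j (?v p) (snd p)" "snd p 0" j] p box_point_in_cube[OF v_unit[OF p]]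
        by (auto simp: box_point_0 interpolate_agree)
    qed (use p h(2) in auto)
  qed
  fix s :: real and t assume st: "0 \<le> s" "s \<le> 1" "t \<in> cube_bdry n"
  have "?\<kappa> (s, t) = 0" "?v (s, t) = 0 \<or> ?v (s, t) = 1" if "t 0 = 0 \<or> t 0 = 1"
    using that \<kappa> v by (auto simp: interpolate_agree interval_reparam_def)
  moreover have "?v (s, t) \<in> {0..1}" using v_unit[of "(s, t)"] st cube_bdry_in_cube by auto
  ultimately have "?H (s, t) = \<beta> 0" "?G (s, t) j = a j" for j
    using st base_map_bdry[of t "?\<kappa> (s, t)"] box_point_in_bdry[of t "?v (s, t)" j] h(2) by auto
  then have "?H (s, t) = \<beta> 0" "?G (s, t) = a" by auto
  then show "adj_point a (?H (s, t)) (?G (s, t)) = adj_incl (\<beta> 0)" by (simp only: adj_point_base)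
qed (simp_all add: assemble_def)

lemma assemble_homotopic_profiles:
  assumes g: "\<And>j. cube_loop n (A j) (a j) (g j)"
    and \<kappa>: "interval_reparam \<kappa>" "\<kappa> 0 = 0" "\<kappa> 1 = 0" "interval_reparam \<kappa>'" "\<kappa>' 0 = 0" "\<kappa>' 1 = 0"
    and v: "interval_reparam v" "interval_reparam v'" "v 0 = v' 0" "v 1 = v' 1"
    and support: "\<And>j s u t. \<lbrakk>t \<in> topspace (cube n); t 0 = interpolate v v' s u; g j t \<noteq> a j\<rbrakk>
      \<Longrightarrow> \<kappa> u = 1 \<and> \<kappa>' u = 1"
  shows "adj_cube_homotopic (assemble \<kappa> v g) (assemble \<kappa>' v' g)"
proof -
  have "continuous_map (homotopy_cube n) (A j) (\<lambda>p. g j (snd p))" for j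
    using continuous_map_compose[OF continuous_map_homotopy_point conjunct1[OF g]] by (simp add: o_def)
  then show ?thesis
    using assemble_homotopic[of "\<lambda>j p. g j (snd p)" \<kappa> \<kappa>' v v'] cube_loop_bdry[OF g] \<kappa> v support by simp
qed

definition box_family :: "(nat \<Rightarrow> (nat \<Rightarrow> real) \<Rightarrow> 'b) \<Rightarrow> (nat \<Rightarrow> real) \<Rightarrow> nat \<Rightarrow> 'a + nat \<times> 'b" where
  "box_family = assemble plateau stretch"

lemma box_family_homotopic:
  assumes "\<And>j. cube_homotopic n (A j) (a j) (g j) (g' j)"
  shows "adj_cube_homotopic (box_family g) (box_family g')"
proof -
  have "\<exists>h. continuous_map (homotopy_cube n) (A j) h \<and> (\<forall>t. h (0, t) = g j t) \<and> (\<forall>t. h (1, t) = g' j t) \<and>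
    (\<forall>s t. 0 \<le> s \<longrightarrow> s \<le> 1 \<longrightarrow> t \<in> cube_bdry n \<longrightarrow> h (s, t) = a j)" for j
    using cube_homotopicE[OF assms[of j]] by metis
  then obtain h where h: "\<And>j. continuous_map (homotopy_cube n) (A j) (h j)"
    "\<And>j t. h j (0, t) = g j t" "\<And>j t. h j (1, t) = g' j t"
    "\<And>j s t. \<lbrakk>0 \<le> s; s \<le> 1; t \<in> cube_bdry n\<rbrakk> \<Longrightarrow> h j (s, t) = a j"
    by metis
  have "plateau u = 1"
    if "0 \<le> s" "s \<le> 1" "t \<in> topspace (cube n)" "t 0 = stretch u" "h j (s, t) \<noteq> a j" for j s u t
  proof -
    have "t 0 \<noteq> 0" "t 0 \<noteq> 1" using in_cube_bdryI[OF that(3) n_gt_0] h(4) that by auto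
    then show ?thesis using that(4) by (simp add: plateau_over_stretch)
  qed
  then have "adj_cube_homotopic (assemble plateau stretch (\<lambda>j t. h j (0, t)))
      (assemble plateau stretch (\<lambda>j t. h j (1, t)))"
    using h by (intro assemble_homotopic interval_reparam_plateau interval_reparam_stretch)
      (auto simp: plateau_eq interpolate_agree)
  then show ?thesis by (simp add: h box_family_def)
qed

lemma cube_loop_box_family:
  assumes "\<And>j. cube_loop n (A j) (a j) (g j)"
  shows "cube_loop n Y (adj_incl (\<beta> 0)) (box_family g)"
  using box_family_homotopic[of g g] assms by (simp only: homotopic_with_refl)

lemma box_family_concat:
  assumes g: "\<And>j. cube_loop n (A j) (a j) (g j)" "\<And>j. cube_loop n (A j) (a j) (g' j)"
    and t: "t \<in> topspace (cube n)"
  shows "cube_concat_along 0 (box_family g) (box_family g') t =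
    assemble twin_plateau twin_stretch (\<lambda>j. cube_concat_along 0 (g j) (g' j)) t"
proof (cases "t 0 \<le> 1/2")
  case True
  then have "twin_stretch (t 0) \<le> 1/2" "2 * twin_stretch (t 0) = stretch (2 * t 0)"
    using stretch_bounds[of "2 * t 0"] by (simp_all add: twin_stretch_eq)
  then show ?thesis
    using True
    by (simp add: cube_concat_along_def box_family_def assemble_def base_map_upd box_point_upd box_point_0
        twin_plateau_eq)
next
  case False
  let ?w = "twin_stretch (t 0)"
  have w: "1/2 \<le> ?w" "?w \<le> 1" "2 * ?w = 1 + stretch (2 * t 0 - 1)"
    using False stretch_bounds[of "2 * t 0 - 1"] by (simp_all add: twin_stretch_eq)
  then have "cube_concat_along 0 (g j) (g' j) (box_point j ?w t)
      = g' j (box_point j (stretch (2 * t 0 - 1)) t)" for j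
    using cube_concat_along_upper_half[OF g box_point_in_cube[of ?w] n_gt_0]
    by (simp add: box_point_0 box_point_upd)
  moreover have "cube_concat_along 0 (box_family g) (box_family g') t = box_family g' (t(0 := 2 * t 0 - 1))"
    using False by (simp add: cube_concat_along_def)
  ultimately show ?thesis
    using False by (simp add: box_family_def assemble_def base_map_upd box_point_upd twin_plateau_eq)
qed

text \<open>First the wall \<open>t 0 = 1/2\<close>, where all boxes are at their base points, is lifted to the resting places;
  then the boxes of the two factors, which now lie over a common plateau, are pushed together.\<close>

lemma box_family_concat_homotopic:
  assumes g: "\<And>j. cube_loop n (A j) (a j) (g j)" "\<And>j. cube_loop n (A j) (a j) (g' j)"
  shows "adj_cube_homotopic (cube_concat_along 0 (box_family g) (box_family g'))
    (box_family (\<lambda>j. cube_concat_along 0 (g j) (g' j)))"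
proof -
  define G where "G j = cube_concat_along 0 (g j) (g' j)" for j
  have G: "cube_loop n (A j) (a j) (G j)" for j
    unfolding G_def by (rule cube_loop_concat_along[OF g n_gt_0])
  have G_support: "t 0 \<notin> {0, 1/2, 1}" if "t \<in> topspace (cube n)" "G j t \<noteq> a j" for j t
    using cube_concat_along_wall[OF g that(1) n_gt_0] that(2) unfolding G_def by blast
  note reparams = interval_reparam_plateau interval_reparam_stretch
    interval_reparam_twin_plateau interval_reparam_twin_stretch
  note profile_eqs = plateau_eq stretch_eq twin_plateau_eq twin_stretch_eq
  have "adj_cube_homotopic (assemble twin_plateau twin_stretch G) (assemble plateau twin_stretch G)"
  proof (rule assemble_homotopic_profiles[OF G])
    fix j u t and s :: real
    assume "t \<in> topspace (cube n)" "t 0 = interpolate twin_stretch twin_stretch s u" "G j t \<noteq> a j"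
    then have "twin_stretch u \<notin> {0, 1/2, 1}" using G_support[of t j] by (simp add: interpolate_agree)
    then show "twin_plateau u = 1 \<and> plateau u = 1" using twin_stretch_interior by blast
  qed (simp_all add: reparams profile_eqs)
  moreover have "adj_cube_homotopic (assemble plateau twin_stretch G) (assemble plateau stretch G)"
  proof (rule assemble_homotopic_profiles[OF G])
    fix j u t and s :: real
    assume "t \<in> topspace (cube n)" "t 0 = interpolate twin_stretch stretch s u" "G j t \<noteq> a j"
    then have "interpolate twin_stretch stretch s u \<notin> {0, 1}" using G_support[of t j] by simp
    then show "plateau u = 1 \<and> plateau u = 1" using plateau_over_interpolation by blast
  qed (simp_all add: reparams profile_eqs)
  ultimately have "adj_cube_homotopic (assemble twin_plateau twin_stretch G) (box_family G)"
    unfolding box_family_def by (rule homotopic_with_trans)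
  then show ?thesis
    by (rule cube_homotopic_cong) (simp_all add: box_family_concat[OF g] G_def[abs_def])
qed

lemma adj_r_box_family: "cube_homotopic n X (\<beta> 0) (adj_r \<circ> box_family g) (\<lambda>t. \<beta> 0)"
proof (rule cube_homotopicI)
  let ?c = "\<lambda>p. interpolate plateau (\<lambda>u. 0) (fst p) (snd p 0)"
  have "continuous_map (homotopy_cube n) (top_of_set {0..1}) ?c"
    by (intro continuous_map_interpolate interval_reparam_plateau continuous_map_homotopy_time
        continuous_map_homotopy_coord n_gt_0 interval_reparam_const) simp
  from continuous_map_base_map[OF this continuous_map_homotopy_point]
  show "continuous_map (homotopy_cube n) X (\<lambda>p. base_map (?c p) (snd p))" .
qed (auto simp: box_family_def assemble_def adj_r_point base_map_def[of 0] plateau_eq interpolate_def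
    intro!: base_map_bdry)

lemma adj_rj_box_family:
  assumes g: "\<And>j. cube_loop n (A j) (a j) (g j)"
  shows "cube_homotopic n (A j) (a j) (adj_rj a j \<circ> box_family g) (g j)"
proof (rule cube_homotopic_cong)
  show "cube_homotopic n (A j) (a j) (\<lambda>t. g j (\<lambda>i\<in>{..<n}. box_coord j i (t i))) (\<lambda>t. g j (\<lambda>i\<in>{..<n}. t i))"
    using box_coord_ends
    by (intro cube_homotopic_reparametrize g interval_reparam_box_coord interval_reparam_id) auto
  fix t assume t: "t \<in> topspace (cube n)"
  have "plateau u = 1" if "g k (box_point k (stretch u) t) \<noteq> a k" for k u
  proof -
    have "box_point k (stretch u) t \<notin> cube_bdry n" using cube_loop_bdry[OF g] that by blast
    then have "stretch u \<notin> {0, 1}"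
      using in_cube_bdryI[OF box_point_in_cube[of "stretch u"] n_gt_0]
      by (auto simp: box_point_0 stretch_bounds)
    then show ?thesis by (rule plateau_over_stretch)
  qed
  then have "adj_compatible x a (base_map (plateau (t 0)) t) (\<lambda>j. g j (box_point j (stretch (t 0)) t))"
    using cube_loop_bdry[OF g] stretch_bounds by (intro adj_compatible_boxes) auto
  then have "(adj_rj a j \<circ> box_family g) t = g j (box_point j (stretch (t 0)) t)"
    by (simp add: box_family_def assemble_def adj_rj_point)
  also have "box_point j (stretch (t 0)) t = (\<lambda>i\<in>{..<n}. box_coord j i (t i))"
    by (auto simp: box_point_def box_coord_def fun_eq_iff)
  finally show "(adj_rj a j \<circ> box_family g) t = g j (\<lambda>i\<in>{..<n}. box_coord j i (t i))" .
  show "g j t = g j (\<lambda>i\<in>{..<n}. t i)"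
    using cube_extensional[OF t] by (simp add: extensional_restrict)
qed

definition attached_class ::
    "(nat \<Rightarrow> ((nat \<Rightarrow> real) \<Rightarrow> 'b) set) \<Rightarrow> ((nat \<Rightarrow> real) \<Rightarrow> nat \<Rightarrow> 'a + nat \<times> 'b) set" where
  "attached_class D = hclass n Y (adj_incl (\<beta> 0)) (box_family (\<lambda>j. SOME g. g \<in> D j))"

abbreviation \<pi>X :: "((nat \<Rightarrow> real) \<Rightarrow> 'a) set monoid" where
  "\<pi>X \<equiv> homotopy_group n X (\<beta> 0)"

abbreviation \<pi>A :: "nat \<Rightarrow> ((nat \<Rightarrow> real) \<Rightarrow> 'b) set monoid" where
  "\<pi>A j \<equiv> homotopy_group n (A j) (a j)"

abbreviation \<pi>Y :: "((nat \<Rightarrow> real) \<Rightarrow> nat \<Rightarrow> 'a + nat \<times> 'b) set monoid" where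
  "\<pi>Y \<equiv> homotopy_group n Y (adj_incl (\<beta> 0))"

lemma attached_class_hclass:
  assumes "\<And>j. cube_loop n (A j) (a j) (g j)"
  shows "attached_class (\<lambda>j. hclass n (A j) (a j) (g j)) = hclass n Y (adj_incl (\<beta> 0)) (box_family g)"
  unfolding attached_class_def
  by (rule hclass_eqI[symmetric]) (intro box_family_homotopic hclass_representative_homotopic assms)

lemma attached_class_in_hom: "attached_class \<in> hom (product_group UNIV \<pi>A) \<pi>Y"
proof (rule homI)
  fix C assume "C \<in> carrier (product_group UNIV \<pi>A)"
  then obtain f where f: "\<And>j. cube_loop n (A j) (a j) (f j)" "C = (\<lambda>j. hclass n (A j) (a j) (f j))"
    by (rule in_product_homotopy_groupE) blast
  then show "attached_class C \<in> carrier \<pi>Y"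
    by (simp add: attached_class_hclass hclass_in_carrier cube_loop_box_family)
  fix D assume "D \<in> carrier (product_group UNIV \<pi>A)"
  then obtain g where g: "\<And>j. cube_loop n (A j) (a j) (g j)" "D = (\<lambda>j. hclass n (A j) (a j) (g j))"
    by (rule in_product_homotopy_groupE) blast
  let ?fg = "\<lambda>j. cube_concat_along 0 (f j) (g j)"
  have "attached_class (C \<otimes>\<^bsub>product_group UNIV \<pi>A\<^esub> D) = attached_class (\<lambda>j. hclass n (A j) (a j) (?fg j))"
    by (simp add: f g hclass_mult n_gt_0 restrict_UNIV)
  also have "\<dots> = hclass n Y (adj_incl (\<beta> 0)) (box_family ?fg)"
    by (intro attached_class_hclass cube_loop_concat_along f g n_gt_0)
  also have "\<dots> = hclass n Y (adj_incl (\<beta> 0)) (cube_concat_along 0 (box_family f) (box_family g))"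
    by (intro hclass_eqI[symmetric] box_family_concat_homotopic f g)
  also have "\<dots> = attached_class C \<otimes>\<^bsub>\<pi>Y\<^esub> attached_class D"
    by (simp only: f(2) g(2) attached_class_hclass[OF f(1)] attached_class_hclass[OF g(1)]
        hclass_mult[OF cube_loop_box_family[OF f(1)] cube_loop_box_family[OF g(1)] n_gt_0])
  finally show "attached_class (C \<otimes>\<^bsub>product_group UNIV \<pi>A\<^esub> D) = attached_class C \<otimes>\<^bsub>\<pi>Y\<^esub> attached_class D" .
qed

lemma induced_attached_class:
  assumes "D \<in> carrier (product_group UNIV \<pi>A)"
  shows "induced_hom n X (\<beta> 0) adj_r (attached_class D) = \<one>\<^bsub>\<pi>X\<^esub>"
    and "induced_hom n (A j) (a j) (adj_rj a j) (attached_class D) = D j"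
proof -
  obtain g where g: "\<And>j. cube_loop n (A j) (a j) (g j)" "D = (\<lambda>j. hclass n (A j) (a j) (g j))"
    using assms by (rule in_product_homotopy_groupE) blast
  note loop = cube_loop_box_family[OF g(1)]
  show "induced_hom n X (\<beta> 0) adj_r (attached_class D) = \<one>\<^bsub>\<pi>X\<^esub>"
    unfolding g(2) attached_class_hclass[OF g(1)] one_homotopy_group
      induced_hom_hclass[where \<phi> = adj_r, OF loop continuous_map_adj_r adj_r_incl]
    by (rule hclass_eqI[OF adj_r_box_family])
  show "induced_hom n (A j) (a j) (adj_rj a j) (attached_class D) = D j"
    unfolding g(2) attached_class_hclass[OF g(1)]
      induced_hom_hclass[where \<phi> = "adj_rj a j", OF loop continuous_map_retraction adj_rj_incl]
    by (rule hclass_eqI[OF adj_rj_box_family[OF g(1)]])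
qed

definition adj_section ::
    "((nat \<Rightarrow> real) \<Rightarrow> 'a) set \<times> (nat \<Rightarrow> ((nat \<Rightarrow> real) \<Rightarrow> 'b) set)
      \<Rightarrow> ((nat \<Rightarrow> real) \<Rightarrow> nat \<Rightarrow> 'a + nat \<times> 'b) set" where
  "adj_section = (\<lambda>(C, D). induced_hom n Y (adj_incl (\<beta> 0)) adj_incl C \<otimes>\<^bsub>\<pi>Y\<^esub> attached_class D)"

lemma base_point_in: "\<beta> 0 \<in> topspace X"
  using funcset_mem[OF continuous_map_funspace[OF path], of 0] by simp

lemma induced_incl_in_hom: "induced_hom n Y (adj_incl (\<beta> 0)) adj_incl \<in> hom \<pi>X \<pi>Y"
  by (rule induced_hom_in_hom[OF continuous_map_inclusion refl n_gt_0])

lemma adj_section_in_hom: "adj_section \<in> hom (\<pi>X \<times>\<times> product_group UNIV \<pi>A) \<pi>Y"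
proof -
  have "adj_incl (\<beta> 0) \<in> topspace Y"
    using funcset_mem[OF continuous_map_funspace[OF continuous_map_inclusion] base_point_in] .
  then interpret \<pi>Y: comm_group \<pi>Y by (rule comm_group_homotopy_group[OF n_ge_2])
  have "group \<pi>X" "group (product_group UNIV \<pi>A)"
    using base_point_in a_in by (simp_all add: group_homotopy_group n_gt_0)
  then show ?thesis
    unfolding adj_section_def case_prod_unfold
    by (intro \<pi>Y.hom_group_mult) (simp_all add: hom_of_fst[unfolded o_def] hom_of_snd[unfolded o_def]
        induced_incl_in_hom attached_class_in_hom)
qed

lemma adj_Psi_section:
  assumes "c \<in> carrier (\<pi>X \<times>\<times> product_group UNIV \<pi>A)"
  shows "adj_Psi n X (\<beta> 0) A a (adj_section c) = c"
proof -
  obtain C D where c: "c = (C, D)" "C \<in> carrier \<pi>X" and D: "D \<in> carrier (product_group UNIV \<pi>A)"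
    using assms by (cases c) auto
  interpret \<pi>X: group \<pi>X by (rule group_homotopy_group[OF n_gt_0 base_point_in])
  interpret \<pi>A: group "\<pi>A j" for j by (rule group_homotopy_group[OF n_gt_0 a_in])
  let ?i = "induced_hom n Y (adj_incl (\<beta> 0)) adj_incl"
  have in_\<pi>Y: "?i C \<in> carrier \<pi>Y" "attached_class D \<in> carrier \<pi>Y"
    by (rule hom_in_carrier[OF induced_incl_in_hom c(2)], rule hom_in_carrier[OF attached_class_in_hom D])
  note compose = induced_hom_compose[OF c(2) continuous_map_inclusion refl]
  have "induced_hom n X (\<beta> 0) adj_r (?i C) = C"
    using compose[where \<psi> = adj_r, OF continuous_map_adj_r adj_r_incl]
    by (simp add: adj_r_comp_incl induced_hom_id c(2))
  then have "induced_hom n X (\<beta> 0) adj_r (adj_section c) = C"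
    using hom_mult[OF induced_hom_in_hom[where \<phi> = adj_r, OF continuous_map_adj_r adj_r_incl n_gt_0] in_\<pi>Y]
    by (simp add: adj_section_def c induced_attached_class(1)[OF D])
  moreover have "induced_hom n (A j) (a j) (adj_rj a j) (?i C) = \<one>\<^bsub>\<pi>A j\<^esub>" for j
    using compose[where \<psi> = "adj_rj a j", OF continuous_map_retraction adj_rj_incl]
    by (simp add: adj_rj_comp_incl induced_hom_const)
  then have "induced_hom n (A j) (a j) (adj_rj a j) (adj_section c) = D j" for j
    using D hom_mult[OF induced_hom_in_hom[where \<phi> = "adj_rj a j",
          OF continuous_map_retraction adj_rj_incl n_gt_0] in_\<pi>Y]
    by (simp add: adj_section_def c induced_attached_class(2)[OF D] PiE_UNIV_domain Pi_iff)
  ultimately show ?thesis by (simp add: adj_Psi_def c(1))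
qed

end

lemma hom_into_product_group:
  assumes "\<And>i. i \<in> I \<Longrightarrow> f i \<in> hom G (H i)"
  shows "(\<lambda>x. \<lambda>i\<in>I. f i x) \<in> hom G (product_group I H)"
  by (rule homI) (auto simp: hom_in_carrier[OF assms] hom_mult[OF assms])

lemma adj_Psi_in_hom:
  assumes "\<And>j. a j \<in> topspace (A j)" "0 < n"
  shows "adj_Psi n X y0 A a \<in> hom (homotopy_group n (Adj X x A a) (adj_incl y0))
    (homotopy_group n X y0 \<times>\<times> product_group UNIV (\<lambda>j. homotopy_group n (A j) (a j)))"
proof -
  let ?\<pi>Y = "homotopy_group n (Adj X x A a) (adj_incl y0)"
  have "induced_hom n X y0 adj_r \<in> hom ?\<pi>Y (homotopy_group n X y0)"
    by (rule induced_hom_in_hom[where \<phi> = adj_r, OF continuous_map_adj_r adj_r_incl assms(2)])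
  moreover have "induced_hom n (A j) (a j) (adj_rj a j)
      \<in> hom ?\<pi>Y (homotopy_group n (A j) (a j))" for j
    by (rule induced_hom_in_hom[where \<phi> = "adj_rj a j", OF continuous_map_adj_rj adj_rj_incl assms(2)])
      (rule assms(1))
  then have "(\<lambda>C. \<lambda>j\<in>UNIV. induced_hom n (A j) (a j) (adj_rj a j) C)
      \<in> hom ?\<pi>Y (product_group UNIV (\<lambda>j. homotopy_group n (A j) (a j)))"
    by (rule hom_into_product_group)
  ultimately show ?thesis
    unfolding adj_Psi_def[abs_def] by (simp add: hom_paired restrict_UNIV)
qed

theorem theorem3p12:
  fixes X :: "'a topology" and x :: "nat \<Rightarrow> 'a" and y0 :: 'a
    and A :: "nat \<Rightarrow> 'b topology" and a :: "nat \<Rightarrow> 'b" and n :: nat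
  assumes "peano_continuum X"
    and "y0 \<in> topspace X"
    and "\<And>j. x j \<in> topspace X"
    and "\<And>j. Hausdorff_space (A j)"
    and "\<And>j. a j \<in> topspace (A j)"
    and "n \<ge> 2"
  shows "adj_Psi n X y0 A a \<in> hom (homotopy_group n (Adj X x A a) (adj_incl y0))
           (homotopy_group n X y0 \<times>\<times> product_group UNIV (\<lambda>j. homotopy_group n (A j) (a j)))
       \<and> (\<exists>s \<in> hom (homotopy_group n X y0 \<times>\<times> product_group UNIV (\<lambda>j. homotopy_group n (A j) (a j)))
                    (homotopy_group n (Adj X x A a) (adj_incl y0)).
            \<forall>g \<in> carrier (homotopy_group n X y0 \<times>\<times> product_group UNIV (\<lambda>j. homotopy_group n (A j) (a j))).
              adj_Psi n X y0 A a (s g) = g)"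
proof -
  obtain \<beta> and l r :: "nat \<Rightarrow> real" where start: "\<beta> 0 = y0" and path:
    "continuous_map (top_of_set {0..1}) X \<beta>" "\<And>j. 0 \<le> l j \<and> l j < r j \<and> r j \<le> 1"
    "\<And>j t. t \<in> {l j..r j} \<Longrightarrow> \<beta> t = x j" "\<And>i j. i \<noteq> j \<Longrightarrow> r i < l j \<or> r j < l i"
    by (rule peano_continuum_resting_path[where x = x, OF assms(1-3)]) (rule that)
  interpret adj_resting_path X x A a n \<beta> l r
    by unfold_locales (use assms path in auto)
  show ?thesis
    by (intro conjI bexI[of _ adj_section] ballI adj_Psi_in_hom adj_section_in_hom[unfolded start]
        adj_Psi_section[unfolded start] assms(5) n_gt_0)
qed

end
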